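(* Let $K_1,K_2$ be compact Choquet simplexes and let $F\subset K_1$ be a closed face. Let $f\in A(F,A(K_2))$ be non-negative, i.e. $f(k)\ge0$ in $A(K_2)$ for every $k\in F$. Then there is a non-negative $g\in A(K_1,A(K_2))$ with $g|_F=f$ and $\sup_{k\in K_1}\|g(k)\|=\sup_{k\in F}\|f(k)\|$.
   Context: $A(K_2)$ is the order unit space of real-valued affine continuous functions on $K_2$ with the supremum norm and pointwise order. For a compact convex set $L$, $A(L,A(K_2))$ is the space of affine maps $L\to A(K_2)$ continuous for the norm topology, with the supremum norm; non-negativity is pointwise in $A(K_2)$. *)

theory Defs
  imports "HOL-Analysis.Analysis"
begin

definition lctvs :: "'a::{real_vector,t2_space} itself \<Rightarrow> bool" where
  "lctvs _ \<longleftrightarrow>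
     continuous_on UNIV (\<lambda>p::'a \<times> 'a. fst p + snd p) \<and>
     continuous_on UNIV (\<lambda>p::real \<times> 'a. fst p *\<^sub>R snd p) \<and>
     (\<forall>x::'a. \<forall>U. open U \<and> x \<in> U \<longrightarrow> (\<exists>V. open V \<and> convex V \<and> x \<in> V \<and> V \<subseteq> U))"

text \<open>The cone generated by K placed at height 1 in E x R.\<close>
definition cone_over :: "'a::real_vector set \<Rightarrow> ('a \<times> real) set" where
  "cone_over K = {(c *\<^sub>R x, c) | c x. 0 \<le> c \<and> x \<in> K}"

definition cone_le :: "('a::real_vector) set \<Rightarrow> 'a \<Rightarrow> 'a \<Rightarrow> bool" where
  "cone_le C u v \<longleftrightarrow> v - u \<in> C"

definition lattice_cone :: "('a::real_vector) set \<Rightarrow> bool" where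
  "lattice_cone C \<longleftrightarrow>
     (\<forall>u\<in>C. \<forall>v\<in>C.
        (\<exists>w\<in>C. cone_le C w u \<and> cone_le C w v \<and>
              (\<forall>z\<in>C. cone_le C z u \<and> cone_le C z v \<longrightarrow> cone_le C z w)) \<and>
        (\<exists>w\<in>C. cone_le C u w \<and> cone_le C v w \<and>
              (\<forall>z\<in>C. cone_le C u z \<and> cone_le C v z \<longrightarrow> cone_le C w z)))"

text \<open>Choquet simplex: nonempty compact convex set whose generated cone is a lattice
  (definition of Choquet/Phelps/Alfsen; equivalent to uniqueness of maximal
  representing measures by the Choquet--Meyer theorem).\<close>
definition choquet_simplex :: "'a::{real_vector,topological_space} set \<Rightarrow> bool" where
  "choquet_simplex K \<longleftrightarrow> K \<noteq> {} \<and> compact K \<and> convex K \<and> lattice_cone (cone_over K)"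

definition affine_fun_on :: "'a::real_vector set \<Rightarrow> ('a \<Rightarrow> real) \<Rightarrow> bool" where
  "affine_fun_on K h \<longleftrightarrow>
     (\<forall>x\<in>K. \<forall>y\<in>K. \<forall>t\<in>{0..1}. h ((1 - t) *\<^sub>R x + t *\<^sub>R y) = (1 - t) * h x + t * h y)"

text \<open>Membership in A(K): continuous affine real functions on K (values off K irrelevant).\<close>
definition in_A :: "'a::{real_vector,topological_space} set \<Rightarrow> ('a \<Rightarrow> real) \<Rightarrow> bool" where
  "in_A K h \<longleftrightarrow> continuous_on K h \<and> affine_fun_on K h"

definition supnorm :: "'a set \<Rightarrow> ('a \<Rightarrow> real) \<Rightarrow> real" where
  "supnorm K h = (SUP y\<in>K. \<bar>h y\<bar>)"

text \<open>Membership in A(L, A(K)): affine maps L \<rightarrow> A(K), continuous for the sup-norm on A(K).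
  Elements of A(K) are represented by functions, compared on K only.\<close>
definition in_AA :: "'a::{real_vector,topological_space} set \<Rightarrow> 'b::{real_vector,topological_space} set
                     \<Rightarrow> ('a \<Rightarrow> 'b \<Rightarrow> real) \<Rightarrow> bool" where
  "in_AA L K f \<longleftrightarrow>
     (\<forall>k\<in>L. in_A K (f k)) \<and>
     (\<forall>x\<in>L. \<forall>y\<in>L. \<forall>t\<in>{0..1}. \<forall>z\<in>K.
         f ((1 - t) *\<^sub>R x + t *\<^sub>R y) z = (1 - t) * f x z + t * f y z) \<and>
     (\<forall>k\<in>L. \<forall>e>0. \<exists>U. open U \<and> k \<in> U \<and>
         (\<forall>k'\<in>L \<inter> U. supnorm K (\<lambda>z. f k' z - f k z) < e))"

end

theory Submission
  imports Defs
begin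

text \<open>Both simplexes enter. On \<open>K1\<close>, finitely many affine continuous functions given on closed
  faces, each lower one strictly below each upper one, can be strictly interpolated by an element of
  \<open>A(K1)\<close>: the convex hulls of their graphs are disjoint by Riesz decomposition in the lattice cone
  over \<open>K1\<close>, and a Hahn--Banach functional separating them is not vertical. On \<open>K2\<close>, interpolation
  and Fourier--Motzkin elimination give affine partitions of unity \<open>w z\<close> with
  \<open>h \<approx> (\<Sum>z. h z * w z)\<close> uniformly for \<open>h\<close> in a compact subset of \<open>A(K2)\<close>. An approximate
  extension \<open>g\<close> of \<open>f\<close> is therefore improved to \<open>\<Sum>z. b z k * w z x\<close>, where \<open>b z\<close> is
  interpolated close to \<open>g k z\<close> on \<open>K1\<close> and much closer to \<open>f k z\<close> on \<open>F\<close>, with values in a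
  slightly shrunk neighbourhood of \<open>[0, r]\<close>, \<open>r\<close> being the norm of \<open>f\<close>. These improvements
  converge uniformly.\<close>

subsection \<open>Hahn--Banach separation in locally convex spaces\<close>

text \<open>For one fixed \<open>z\<close> in \<open>K2\<close>, extending \<open>f k z\<close> in
  the variable \<open>k\<close> is a scalar problem on \<open>K1\<close>; the obstacle is that
  extensions chosen separately for each \<open>z\<close> need not depend affinely on
  \<open>z\<close>. So choices are made at finitely many \<open>z\<close> only, and the dependence
  on \<open>x\<close> in \<open>K2\<close> is carried by the weights \<open>w z\<close>. The map
  taking \<open>h\<close> to the sum of \<open>h z * w z\<close> is positive and preserves
  constants, so it respects order intervals, and for non-negative \<open>f\<close> the norm
  condition is just such an interval, from 0 to \<open>r\<close>. The price is an error: the map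
  reproduces \<open>h\<close> only approximately, and interpolation is strict, because it is
  strictness that keeps the two graph hulls from meeting. Equality on \<open>F\<close> and the
  closed bounds can therefore be reached only in the limit. For the limit to exist, an improvement
  must stay near its predecessor on all of \<open>K1\<close>, not only on \<open>F\<close>; this is
  compatible with the sharper demands on \<open>F\<close> because the predecessor is already within
  the current error of \<open>f\<close> there and of the interval everywhere.\<close>

definition sublinear :: "('a::real_vector \<Rightarrow> real) \<Rightarrow> bool" where
  "sublinear p \<longleftrightarrow> (\<forall>x y. p (x + y) \<le> p x + p y) \<and> (\<forall>x. \<forall>c>0. p (c *\<^sub>R x) \<le> c * p x)"

lemma sublinear_add: "sublinear p \<Longrightarrow> p (x + y) \<le> p x + p y"
  and sublinear_scale_le: "sublinear p \<Longrightarrow> c > 0 \<Longrightarrow> p (c *\<^sub>R x) \<le> c * p x"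
  by (auto simp: sublinear_def)

text \<open>Rescaling by \<open>1 / c\<close> reverses the inequality. The definition asks for the
  inequality alone because that is what infima of sublinear functions inherit directly.\<close>

lemma sublinear_scale:
  assumes "sublinear p" "c > 0"
  shows "p (c *\<^sub>R x) = c * p x"
proof -
  have "p ((1 / c) *\<^sub>R (c *\<^sub>R x)) \<le> (1 / c) * p (c *\<^sub>R x)"
    using sublinear_scale_le[OF assms(1), of "1 / c" "c *\<^sub>R x"] assms(2) by simp
  then have "c * p x \<le> p (c *\<^sub>R x)"
    using assms(2) by (simp add: field_simps)
  then show ?thesis
    using sublinear_scale_le[OF assms] by (simp add: order_antisym)
qed

lemma sublinear_zero: "sublinear p \<Longrightarrow> p 0 = 0"
  using sublinear_scale[of p 2 0] by simp

lemma sublinear_neg: "sublinear p \<Longrightarrow> - p (- x) \<le> p x"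
  using sublinear_add[of p x "- x"] sublinear_zero[of p] by simp

text \<open>Lowering \<open>q\<close> along a direction \<open>y\<close>, by the infimum over
  \<open>t \<ge> 0\<close> of \<open>q (x + t *\<^sub>R y) - t * q y\<close>, gives a sublinear
  function below \<open>q\<close>. Minimality makes it equal to \<open>q\<close>, and
  \<open>t = 1\<close> then yields superadditivity.\<close>

lemma minimal_sublinear_linear:
  assumes q: "sublinear q" and min: "\<And>r. sublinear r \<Longrightarrow> (\<And>x. r x \<le> q x) \<Longrightarrow> r = q"
  shows "linear q"
proof -
  have super: "q x + q y \<le> q (x + y)" for x y
  proof -
    define r where "r x = (INF t\<in>{0..}. q (x + t *\<^sub>R y) - t * q y)" for x
    have hom: "q (t *\<^sub>R z) = t * q z" if "t \<ge> 0" for t z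
      using that sublinear_scale[OF q, of t] sublinear_zero[OF q] by (cases "t = 0") auto
    have lb: "- q (- x) \<le> q (x + t *\<^sub>R y) - t * q y" if "t \<ge> 0" for x t
      using sublinear_add[OF q, of "x + t *\<^sub>R y" "- x"] hom[OF that, of y] by simp
    then have bdd: "bdd_below ((\<lambda>t. q (x + t *\<^sub>R y) - t * q y) ` {0..})" for x
      by (intro bdd_belowI[of _ "- q (- x)"]) auto
    have r_le: "r x \<le> q (x + t *\<^sub>R y) - t * q y" if "t \<ge> 0" for x t
      unfolding r_def using that by (intro cINF_lower[OF bdd]) auto
    have "sublinear r"
      unfolding sublinear_def
    proof (intro conjI allI impI)
      fix x z
      have "r (x + z) - (q (z + t *\<^sub>R y) - t * q y) \<le> q (x + s *\<^sub>R y) - s * q y"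
        if "s \<ge> 0" "t \<ge> 0" for s t
        using r_le[of "s + t" "x + z"] that
          sublinear_add[OF q, of "x + s *\<^sub>R y" "z + t *\<^sub>R y"]
        by (simp add: algebra_simps)
      then have "r (x + z) - (q (z + t *\<^sub>R y) - t * q y) \<le> r x" if "t \<ge> 0" for t
        unfolding r_def[of x] using that by (intro cINF_greatest) auto
      then have "r (x + z) - r x \<le> q (z + t *\<^sub>R y) - t * q y" if "t \<ge> 0" for t
        using that by (simp add: algebra_simps)
      then have "r (x + z) - r x \<le> r z"
        unfolding r_def[of z] by (intro cINF_greatest) auto
      then show "r (x + z) \<le> r x + r z" by simp
    next
      fix x and c :: real assume c: "c > 0"
      have "r (c *\<^sub>R x) / c \<le> q (x + t *\<^sub>R y) - t * q y" if "t \<ge> 0" for t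
        using r_le[of "c * t" "c *\<^sub>R x"] that c sublinear_scale[OF q c, of "x + t *\<^sub>R y"]
        by (simp add: field_simps scaleR_add_right)
      then have "r (c *\<^sub>R x) / c \<le> r x"
        unfolding r_def[of x] by (intro cINF_greatest) auto
      then show "r (c *\<^sub>R x) \<le> c * r x"
        using c by (simp add: field_simps)
    qed
    then have "r = q"
      by (rule min) (use r_le[of 0] in auto)
    then show ?thesis
      using r_le[of 1 x] by simp
  qed
  have add: "q (x + y) = q x + q y" for x y
    using super sublinear_add[OF q] by (simp add: order_antisym)
  have neg: "q (- x) = - q x" for x
    using add[of x "- x"] sublinear_zero[OF q] by simp
  show ?thesis
  proof (rule linearI)
    fix c x
    show "q (c *\<^sub>R x) = c *\<^sub>R q x"
    proof (cases "c < 0")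
      case True
      then show ?thesis
        using sublinear_scale[OF q, of "- c" "- x"] neg[of x] by simp
    next
      case False
      then show ?thesis
        using sublinear_scale[OF q, of c x] sublinear_zero[OF q] by (cases "c = 0") auto
    qed
  qed (rule add)
qed

text \<open>Zorn provides a minimal sublinear function below \<open>p\<close>, which is linear.
  Infima along chains stay finite because every sublinear \<open>q \<le> p\<close> satisfies
  \<open>- p (- x) \<le> q x\<close>.\<close>

lemma Hahn_Banach_sublinear:
  assumes p: "sublinear p"
  obtains l where "linear l" "\<And>x. l x \<le> p x"
proof -
  define S where "S = {q. sublinear q \<and> q \<le> p}"
  \<comment> \<open>The order is reversed, since Zorn produces maximal elements and a minimal
    function is wanted.\<close>
  define P :: "('a \<Rightarrow> real) \<Rightarrow> ('a \<Rightarrow> real) \<Rightarrow> bool" where "P a b \<longleftrightarrow> b \<le> a" for a b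
  have "\<exists>m\<in>S. \<forall>a\<in>S. P m a \<longrightarrow> a = m"
  proof (rule predicate_Zorn)
    show "partial_order_on S (relation_of P S)"
      unfolding P_def by (rule partial_order_on_relation_ofI) auto
  next
    fix C assume C: "C \<in> Chains (relation_of P S)"
    have CS: "C \<subseteq> S" and tot: "\<And>a b. a \<in> C \<Longrightarrow> b \<in> C \<Longrightarrow> a \<le> b \<or> b \<le> a"
      using C by (auto simp: Chains_def relation_of_def P_def)
    show "\<exists>u\<in>S. \<forall>a\<in>C. P a u"
    proof (cases "C = {}")
      case True
      then show ?thesis using p by (auto simp: S_def)
    next
      case False
      define u where "u x = (INF q\<in>C. q x)" for x
      have lb: "- p (- x) \<le> q x" if "q \<in> C" for q x
      proof -
        have "sublinear q" "q (- x) \<le> p (- x)"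
          using that CS by (auto simp: S_def le_fun_def)
        then show ?thesis using sublinear_neg[of q x] by linarith
      qed
      then have bdd: "bdd_below ((\<lambda>q. q x) ` C)" for x
        by (intro bdd_belowI[of _ "- p (- x)"]) auto
      have u_le: "u x \<le> q x" if "q \<in> C" for q x
        unfolding u_def using that by (intro cINF_lower[OF bdd])
      have "sublinear u"
        unfolding sublinear_def
      proof (intro conjI allI impI)
        fix x y
        have "u (x + y) - q2 y \<le> q1 x" if q: "q1 \<in> C" "q2 \<in> C" for q1 q2
        proof -
          \<comment> \<open>Subadditivity of the infimum needs one function below both
            \<open>q1\<close> and \<open>q2\<close>; the chain contains it.\<close>
          obtain q where "q \<in> C" "q \<le> q1" "q \<le> q2"
            using q tot by blast
          then show ?thesis
            using u_le[of q "x + y"] CS sublinear_add[of q x y]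
            by (force simp: S_def le_fun_def dest: spec[of _ x] spec[of _ y])
        qed
        then have "u (x + y) - q y \<le> u x" if "q \<in> C" for q
          unfolding u_def[of x] using that False by (intro cINF_greatest) auto
        then have "u (x + y) - u x \<le> q y" if "q \<in> C" for q
          using that by (simp add: algebra_simps)
        then have "u (x + y) - u x \<le> u y"
          unfolding u_def[of y] using False by (intro cINF_greatest) auto
        then show "u (x + y) \<le> u x + u y" by simp
      next
        fix x and c :: real assume c: "c > 0"
        have "u (c *\<^sub>R x) / c \<le> q x" if "q \<in> C" for q
          using u_le[OF that, of "c *\<^sub>R x"] CS that c sublinear_scale_le[of q c x]
          by (fastforce simp: field_simps S_def)
        then have "u (c *\<^sub>R x) / c \<le> u x"
          unfolding u_def[of x] using False by (intro cINF_greatest) auto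
        then show "u (c *\<^sub>R x) \<le> c * u x"
          using c by (simp add: field_simps)
      qed
      moreover have "u \<le> p"
      proof -
        obtain q where "q \<in> C" using False by blast
        then have "q \<le> p" using CS by (auto simp: S_def)
        then show ?thesis
          using u_le[OF \<open>q \<in> C\<close>] by (auto simp: le_fun_def intro: order_trans)
      qed
      ultimately show ?thesis
        using u_le by (auto simp: S_def P_def le_fun_def)
    qed
  qed
  then obtain m where m: "m \<in> S" "\<And>a. a \<in> S \<Longrightarrow> a \<le> m \<Longrightarrow> a = m"
    by (auto simp: P_def)
  have "linear m"
  proof (rule minimal_sublinear_linear)
    show "sublinear m" using m by (simp add: S_def)
  next
    fix r assume "sublinear r" "\<And>x. r x \<le> m x"
    then have r: "sublinear r" "r \<le> m" by (auto simp: le_fun_def)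
    moreover have "m \<le> p" using m(1) by (simp add: S_def)
    ultimately show "r = m"
      by (intro m(2)) (auto simp: S_def)
  qed
  with m(1) that show thesis by (auto simp: S_def le_fun_def)
qed

section \<open>Locally convex spaces: vector operations, products, separation\<close>

lemma lctvs_continuous_on_add:
  fixes f g :: "'b::topological_space \<Rightarrow> 'a::{real_vector,t2_space}"
  assumes "lctvs TYPE('a)" "continuous_on S f" "continuous_on S g"
  shows "continuous_on S (\<lambda>x. f x + g x)"
proof -
  have "continuous_on UNIV (\<lambda>p::'a \<times> 'a. fst p + snd p)"
    using assms(1) by (simp add: lctvs_def)
  from continuous_on_compose2[OF this continuous_on_Pair[OF assms(2,3)]] show ?thesis by simp
qed

lemma lctvs_continuous_on_scaleR:
  fixes f :: "'b::topological_space \<Rightarrow> 'a::{real_vector,t2_space}"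
  assumes "lctvs TYPE('a)" "continuous_on S c" "continuous_on S f"
  shows "continuous_on S (\<lambda>x. c x *\<^sub>R f x)"
proof -
  have "continuous_on UNIV (\<lambda>p::real \<times> 'a. fst p *\<^sub>R snd p)"
    using assms(1) by (simp add: lctvs_def)
  from continuous_on_compose2[OF this continuous_on_Pair[OF assms(2,3)]] show ?thesis by simp
qed

lemma lctvs_continuous_on_diff:
  fixes f g :: "'b::topological_space \<Rightarrow> 'a::{real_vector,t2_space}"
  assumes "lctvs TYPE('a)" "continuous_on S f" "continuous_on S g"
  shows "continuous_on S (\<lambda>x. f x - g x)"
  using lctvs_continuous_on_add[OF assms(1,2)
      lctvs_continuous_on_scaleR[OF assms(1) continuous_on_const[of S "-1"] assms(3)]]
  by simp

lemma lctvs_convex_nbhd: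
  fixes x :: "'a::{real_vector,t2_space}"
  assumes "lctvs TYPE('a)" "open U" "x \<in> U"
  obtains V where "open V" "convex V" "x \<in> V" "V \<subseteq> U"
  using assms unfolding lctvs_def by blast

text \<open>Graphs of real functions on a simplex live in this product, and it is there that the
  separation takes place.\<close>

lemma lctvs_prod_real:
  assumes E: "lctvs TYPE('a::{real_vector,t2_space})"
  shows "lctvs TYPE('a \<times> real)"
  unfolding lctvs_def
proof (intro conjI allI impI)
  have "continuous_on UNIV (\<lambda>p::('a \<times> real) \<times> ('a \<times> real).
      (fst (fst p) + fst (snd p), snd (fst p) + snd (snd p)))"
    by (intro continuous_on_Pair lctvs_continuous_on_add[OF E] continuous_intros)
  then show "continuous_on UNIV (\<lambda>p::('a \<times> real) \<times> ('a \<times> real). fst p + snd p)"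
    by (simp add: plus_prod_def)
next
  have "continuous_on UNIV (\<lambda>p::real \<times> ('a \<times> real).
      (fst p *\<^sub>R fst (snd p), fst p *\<^sub>R snd (snd p)))"
    by (intro continuous_on_Pair lctvs_continuous_on_scaleR[OF E] continuous_intros)
  then show "continuous_on UNIV (\<lambda>p::real \<times> ('a \<times> real). fst p *\<^sub>R snd p)"
    by (simp add: scaleR_prod_def)
next
  fix x :: "'a \<times> real" and U assume "open U \<and> x \<in> U"
  then obtain A B where AB: "open A" "open B" "x \<in> A \<times> B" "A \<times> B \<subseteq> U"
    by (metis open_prod_elim)
  from AB(3) have x: "fst x \<in> A" "snd x \<in> B" by (auto simp: mem_Times_iff)
  obtain V where V: "open V" "convex V" "fst x \<in> V" "V \<subseteq> A"
    using lctvs_convex_nbhd[OF E \<open>open A\<close> x(1)] .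
  obtain e where e: "e > 0" "ball (snd x) e \<subseteq> B"
    using \<open>open B\<close> x(2) by (meson open_contains_ball)
  have "V \<times> ball (snd x) e \<subseteq> U" using V(4) e(2) AB(4) by blast
  moreover have "x \<in> V \<times> ball (snd x) e" using V(3) e(1) by (simp add: mem_Times_iff)
  ultimately show "\<exists>V. open V \<and> convex V \<and> x \<in> V \<and> V \<subseteq> U"
    using V(1,2) by (metis convex_Times convex_ball open_Times open_ball)
qed

text \<open>Merging two nonnegative multiples into one is what makes both the modified gauge below
  subadditive and the cone over a convex set closed under addition.\<close>

lemma convex_scaled_sum:
  assumes "convex V" "v \<in> V" "w \<in> V" "r \<ge> 0" "s \<ge> (0::real)"
  obtains u where "u \<in> V" "r *\<^sub>R v + s *\<^sub>R w = (r + s) *\<^sub>R u"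
proof (cases "r + s = 0")
  case True
  then have "r = 0" "s = 0" using assms by auto
  then show ?thesis using that assms by auto
next
  case False
  then have "(r / (r + s)) *\<^sub>R v + (s / (r + s)) *\<^sub>R w \<in> V"
    using assms by (intro convexD) (auto simp: add_divide_distrib[symmetric])
  moreover have "r *\<^sub>R v + s *\<^sub>R w = (r + s) *\<^sub>R ((r / (r + s)) *\<^sub>R v + (s / (r + s)) *\<^sub>R w)"
    using False by (simp add: scaleR_add_right)
  ultimately show ?thesis by (rule that)
qed

lemma lctvs_continuous_linear:
  fixes l :: "'a::{real_vector,t2_space} \<Rightarrow> real"
  assumes E: "lctvs TYPE('a)" and l: "linear l"
    and V: "open V" "0 \<in> V" "\<And>v. v \<in> V \<Longrightarrow> l v \<le> 1"
  shows "continuous_on UNIV l"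
  unfolding continuous_on_def
proof (intro ballI tendstoI)
  fix x :: 'a and e :: real assume e: "e > 0"
  have cont: "continuous_on UNIV (\<lambda>y. c *\<^sub>R (y - x))" for c :: real
    by (intro lctvs_continuous_on_scaleR[OF E] lctvs_continuous_on_diff[OF E]) auto
  \<comment> \<open>Using the factors \<open>2 / e\<close> and \<open>- (2 / e)\<close> together
    replaces symmetry of \<open>V\<close>; the bound 1 on \<open>V\<close> becomes
    \<open>e / 2\<close> for the difference, in both directions.\<close>
  define W where "W c = (\<lambda>y. c *\<^sub>R (y - x)) -` V" for c :: real
  have W: "open (W c)" "x \<in> W c" for c
    unfolding W_def using cont[of c] V by (auto intro: open_vimage)
  have "dist (l y) (l x) < e" if "y \<in> W (2 / e) \<inter> W (- (2 / e))" for y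
  proof -
    have "l ((2 / e) *\<^sub>R (y - x)) \<le> 1" "l (- (2 / e) *\<^sub>R (y - x)) \<le> 1"
      using that V by (auto simp: W_def)
    then have "(2 / e) * (l y - l x) \<le> 1" "- (2 / e) * (l y - l x) \<le> 1"
      unfolding linear_scale[OF l] linear_diff[OF l] by auto
    then have "l y - l x \<le> e / 2" "- (l y - l x) \<le> e / 2"
      using e by (auto simp: field_simps)
    then show ?thesis using e by (auto simp: dist_real_def)
  qed
  then show "\<forall>\<^sub>F y in at x. dist (l y) (l x) < e"
    unfolding eventually_at_topological using W
    by (intro exI[of _ "W (2 / e) \<inter> W (- (2 / e))"]) auto
qed

text \<open>Separating two disjoint compact convex sets reduces to this case by passing to their
  difference set.\<close>

lemma lctvs_separate_zero:
  fixes D :: "'a::{real_vector,t2_space} set"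
  assumes E: "lctvs TYPE('a)" and D: "compact D" "convex D" "D \<noteq> {}" "0 \<notin> D"
  obtains l :: "'a \<Rightarrow> real" where "linear l" "continuous_on UNIV l" "\<And>d. d \<in> D \<Longrightarrow> l d > 0"
proof -
  have "open (- D)" using D(1) compact_imp_closed by auto
  then obtain V where V: "open V" "convex V" "0 \<in> V" "V \<subseteq> - D"
    using lctvs_convex_nbhd[OF E, of "- D" 0] D(4) by auto
  have absorb: "\<exists>r>0. \<exists>v\<in>V. x = r *\<^sub>R v" for x
  proof -
    have "open ((\<lambda>t::real. t *\<^sub>R x) -` V)"
      using V(1) by (intro open_vimage lctvs_continuous_on_scaleR[OF E]) (auto intro: continuous_intros)
    moreover have "0 \<in> (\<lambda>t::real. t *\<^sub>R x) -` V" using V(3) by simp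
    ultimately obtain e where e: "e > 0" "ball 0 e \<subseteq> (\<lambda>t::real. t *\<^sub>R x) -` V"
      by (meson open_contains_ball)
    then have "(e / 2) *\<^sub>R x \<in> V"
      by (auto simp: subset_iff dist_real_def)
    then show ?thesis
      using e by (intro exI[of _ "2 / e"] conjI bexI[of _ "(e / 2) *\<^sub>R x"]) auto
  qed
  \<comment> \<open>\<open>p\<close> is the gauge of \<open>V\<close>, lowered so that it is at most \<open>-1\<close> on \<open>- D\<close>; it stays finite because
    \<open>V\<close> misses \<open>D\<close>.\<close>
  define T where
    "T x = {r - s | r s v d. 0 \<le> r \<and> 0 \<le> s \<and> v \<in> V \<and> d \<in> D \<and> x = r *\<^sub>R v - s *\<^sub>R d}" for x
  define p where "p x = Inf (T x)" for x
  have T_I: "r - s \<in> T (r *\<^sub>R v - s *\<^sub>R d)" if "0 \<le> r" "0 \<le> s" "v \<in> V" "d \<in> D" for r s v d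
    unfolding T_def using that by blast
  obtain d0 where d0: "d0 \<in> D" using D(3) by blast
  have T_ne: "T x \<noteq> {}" for x
  proof -
    obtain r v where "r > 0" "v \<in> V" "x = r *\<^sub>R v" using absorb by blast
    then show ?thesis using T_I[of r 0 v d0] d0 by auto
  qed
  have bdd: "bdd_below (T x)" for x
  proof -
    obtain r0 v0 where 0: "r0 > 0" "v0 \<in> V" "- x = r0 *\<^sub>R v0" using absorb by blast
    \<comment> \<open>If this failed, \<open>d\<close> would be a convex combination of 0 and a
      point \<open>u\<close> of \<open>V\<close>, so \<open>D\<close> would meet
      \<open>V\<close>.\<close>
    have "- r0 \<le> r - s" if rs: "0 \<le> r" "0 \<le> s" "v \<in> V" "d \<in> D" "x = r *\<^sub>R v - s *\<^sub>R d" for r s v d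
    proof (rule ccontr)
      assume "\<not> ?thesis"
      then have s: "r + r0 < s" by simp
      obtain u where u: "u \<in> V" "r *\<^sub>R v + r0 *\<^sub>R v0 = (r + r0) *\<^sub>R u"
        by (rule convex_scaled_sum[OF V(2), of v v0 r r0]) (use rs 0 in auto)
      have "s *\<^sub>R d = (r + r0) *\<^sub>R u"
        using u(2) rs(5) 0(3) by (metis add.commute diff_add_cancel diff_minus_eq_add minus_diff_eq)
      then have "(1 / s) *\<^sub>R (s *\<^sub>R d) = ((r + r0) / s) *\<^sub>R u" by simp
      then have "d = ((r + r0) / s) *\<^sub>R u + (1 - (r + r0) / s) *\<^sub>R 0"
        using s 0 rs by simp
      also have "\<dots> \<in> V"
        using s 0 rs u V by (intro convexD[OF V(2)]) auto
      finally show False using rs V(4) by auto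
    qed
    then show ?thesis
      by (intro bdd_belowI[of _ "- r0"]) (auto simp: T_def)
  qed
  have p_le: "p x \<le> a" if "a \<in> T x" for a x
    unfolding p_def using that bdd by (rule cInf_lower)
  have "sublinear p"
    unfolding sublinear_def
  proof (intro conjI allI impI)
    fix x y
    have "p (x + y) \<le> a + b" if "a \<in> T x" "b \<in> T y" for a b
    proof -
      obtain r s v d where 1: "0 \<le> r" "0 \<le> s" "v \<in> V" "d \<in> D" "a = r - s" "x = r *\<^sub>R v - s *\<^sub>R d"
        using \<open>a \<in> T x\<close> by (auto simp: T_def)
      obtain r' s' v' d' where 2: "0 \<le> r'" "0 \<le> s'" "v' \<in> V" "d' \<in> D" "b = r' - s'"
        "y = r' *\<^sub>R v' - s' *\<^sub>R d'"
        using \<open>b \<in> T y\<close> by (auto simp: T_def)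
      obtain u where u: "u \<in> V" "r *\<^sub>R v + r' *\<^sub>R v' = (r + r') *\<^sub>R u"
        by (rule convex_scaled_sum[OF V(2), of v v' r r']) (use 1 2 in auto)
      obtain e where e: "e \<in> D" "s *\<^sub>R d + s' *\<^sub>R d' = (s + s') *\<^sub>R e"
        by (rule convex_scaled_sum[OF D(2), of d d' s s']) (use 1 2 in auto)
      have "x + y = (r *\<^sub>R v + r' *\<^sub>R v') - (s *\<^sub>R d + s' *\<^sub>R d')"
        using 1 2 by simp
      also have "\<dots> = (r + r') *\<^sub>R u - (s + s') *\<^sub>R e"
        by (simp only: u(2) e(2))
      finally show ?thesis
        using T_I[of "r + r'" "s + s'" u e] p_le[of "(r + r') - (s + s')" "x + y"] 1 2 u(1) e(1) by simp
    qed
    then have "p (x + y) - b \<le> a" if "a \<in> T x" "b \<in> T y" for a b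
      using that by (simp add: algebra_simps)
    then have "p (x + y) - b \<le> p x" if "b \<in> T y" for b
      unfolding p_def[of x] using that T_ne by (intro cInf_greatest) auto
    then have "p (x + y) - p x \<le> b" if "b \<in> T y" for b
      using that by (simp add: algebra_simps)
    then have "p (x + y) - p x \<le> p y"
      unfolding p_def[of y] using T_ne by (intro cInf_greatest) auto
    then show "p (x + y) \<le> p x + p y" by simp
  next
    fix x and c :: real assume c: "c > 0"
    have "p (c *\<^sub>R x) / c \<le> a" if a: "a \<in> T x" for a
    proof -
      obtain r s v d where 1: "0 \<le> r" "0 \<le> s" "v \<in> V" "d \<in> D" "a = r - s" "x = r *\<^sub>R v - s *\<^sub>R d"
        using a by (auto simp: T_def)
      have "c * r - c * s \<in> T (c *\<^sub>R x)"
        using T_I[of "c * r" "c * s" v d] 1 c by (simp add: scaleR_diff_right)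
      then have "p (c *\<^sub>R x) \<le> c * a"
        using p_le 1(5) by (simp add: right_diff_distrib)
      then show ?thesis using c by (simp add: field_simps)
    qed
    then have "p (c *\<^sub>R x) / c \<le> p x"
      unfolding p_def[of x] using T_ne by (intro cInf_greatest) auto
    then show "p (c *\<^sub>R x) \<le> c * p x"
      using c by (simp add: field_simps)
  qed
  then obtain l where l: "linear l" "\<And>x. l x \<le> p x"
    using Hahn_Banach_sublinear by blast
  show thesis
  proof (rule that[OF l(1)])
    show "continuous_on UNIV l"
    proof (rule lctvs_continuous_linear[OF E l(1) V(1,3)])
      fix v assume "v \<in> V"
      then have "1 \<in> T v" using T_I[of 1 0 v d0] d0 by simp
      then show "l v \<le> 1" using p_le l(2)[of v] by fastforce
    qed
  next
    fix d assume "d \<in> D"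
    then have "- 1 \<in> T (- d)" using T_I[of 0 1 0 d] V(3) by simp
    then have "l (- d) \<le> - 1" using p_le l(2)[of "- d"] by fastforce
    then show "l d > 0" by (simp add: linear_neg[OF l(1)])
  qed
qed

subsection \<open>Riesz decomposition in the cone over a simplex\<close>

locale riesz_cone =
  fixes C :: "'a::real_vector set"
  assumes zero_mem: "0 \<in> C"
    and add_mem: "u \<in> C \<Longrightarrow> v \<in> C \<Longrightarrow> u + v \<in> C"
    and pointed: "u \<in> C \<Longrightarrow> - u \<in> C \<Longrightarrow> u = 0"
    and lattice: "lattice_cone C"
begin

lemma sum_mem: "(\<And>i. i \<in> I \<Longrightarrow> v i \<in> C) \<Longrightarrow> sum v I \<in> C"
  by (induct I rule: infinite_finite_induct) (auto simp: zero_mem add_mem)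

lemma greatest_lower_bound:
  assumes u: "u \<in> C" and v: "v \<in> C"
  obtains w where "w \<in> C" "u - w \<in> C" "v - w \<in> C"
    "\<And>z. z \<in> C \<Longrightarrow> u - z \<in> C \<Longrightarrow> v - z \<in> C \<Longrightarrow> w - z \<in> C"
  using lattice[unfolded lattice_cone_def cone_le_def, THEN bspec, OF u, THEN bspec, OF v, THEN conjunct1]
  by blast

text \<open>The first piece is the meet \<open>w\<close> of \<open>u\<close> and \<open>v1\<close>.
  To see that the rest \<open>u - w\<close> is below \<open>v2\<close>, compare with the meet
  \<open>W\<close> of \<open>u + v2\<close> and \<open>v1 + v2\<close>: it dominates
  \<open>u\<close>, while \<open>W - v2\<close> is a lower bound of \<open>u\<close> and
  \<open>v1\<close> and hence below \<open>w\<close>.\<close>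

lemma decompose_two:
  assumes "u \<in> C" "v1 \<in> C" "v2 \<in> C" "v1 + v2 - u \<in> C"
  obtains u1 u2 where "u1 \<in> C" "u2 \<in> C" "u = u1 + u2" "v1 - u1 \<in> C" "v2 - u2 \<in> C"
proof -
  obtain w where w: "w \<in> C" "u - w \<in> C" "v1 - w \<in> C"
    "\<And>z. z \<in> C \<Longrightarrow> u - z \<in> C \<Longrightarrow> v1 - z \<in> C \<Longrightarrow> w - z \<in> C"
    using greatest_lower_bound[OF assms(1,2)] by metis
  obtain W where W: "W \<in> C" "(u + v2) - W \<in> C" "(v1 + v2) - W \<in> C"
    "\<And>z. z \<in> C \<Longrightarrow> (u + v2) - z \<in> C \<Longrightarrow> (v1 + v2) - z \<in> C \<Longrightarrow> W - z \<in> C"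
    using greatest_lower_bound[OF add_mem[OF assms(1,3)] add_mem[OF assms(2,3)]] by metis
  have "W - v2 \<in> C" using W(4)[of v2] assms by simp
  then have 1: "w - (W - v2) \<in> C"
    using W(2,3) by (intro w(4)) (auto simp: algebra_simps)
  have 2: "W - u \<in> C" using W(4)[of u] assms by simp
  have "v2 - (u - w) = (w - (W - v2)) + (W - u)" by simp
  then have "v2 - (u - w) \<in> C" using add_mem[OF 1 2] by metis
  then show ?thesis using that[of w "u - w"] w by simp
qed

lemma decompose_sum:
  assumes "finite J" "\<And>j. j \<in> J \<Longrightarrow> w j \<in> C" "u \<in> C" "sum w J - u \<in> C"
  shows "\<exists>v. (\<forall>j\<in>J. v j \<in> C \<and> w j - v j \<in> C) \<and> u = sum v J"
  using assms
proof (induct J arbitrary: u rule: finite_induct)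
  case empty
  then show ?case using pointed[of u] by simp
next
  case (insert j J)
  have "sum w J \<in> C" using insert by (intro sum_mem) auto
  then obtain u1 u2 where u: "u1 \<in> C" "u2 \<in> C" "u = u1 + u2" "w j - u1 \<in> C" "sum w J - u2 \<in> C"
    using decompose_two[of u "w j" "sum w J"] insert by auto
  obtain v where v: "\<forall>i\<in>J. v i \<in> C \<and> w i - v i \<in> C" "u2 = sum v J"
    using insert u by blast
  have "sum (v(j := u1)) J = sum v J"
    using insert(2) by (intro sum.cong) auto
  then show ?case
    using insert v u by (intro exI[of _ "v(j := u1)"]) auto
qed

text \<open>The \<open>u i j\<close> form a matrix with prescribed row and column sums. Rows are
  peeled off one at a time: \<open>v i\<close> is spread over the columns, and each column keeps
  what is left. With no rows remaining the columns sum to 0 and pointedness makes each of them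
  vanish.\<close>

lemma common_refinement:
  assumes "finite I" "finite J" "\<And>i. i \<in> I \<Longrightarrow> v i \<in> C" "\<And>j. j \<in> J \<Longrightarrow> w j \<in> C"
    "sum v I = sum w J"
  shows "\<exists>u. (\<forall>i\<in>I. \<forall>j\<in>J. u i j \<in> C) \<and> (\<forall>i\<in>I. v i = (\<Sum>j\<in>J. u i j)) \<and>
    (\<forall>j\<in>J. w j = (\<Sum>i\<in>I. u i j))"
  using assms(1,3-)
proof (induct I arbitrary: w rule: finite_induct)
  case empty
  have "w j = 0" if "j \<in> J" for j
  proof (rule pointed)
    have "- w j = sum w (J - {j})"
      using empty sum.remove[OF assms(2) that, of w] by (simp add: minus_unique)
    then show "- w j \<in> C" using empty by (auto intro: sum_mem)
  qed (use that empty in auto)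
  then show ?case by simp
next
  case (insert i I)
  have "sum v I \<in> C" using insert by (intro sum_mem) auto
  moreover have "sum w J - v i = sum v I" using insert by (simp flip: insert.prems(3))
  ultimately obtain x where x: "\<forall>j\<in>J. x j \<in> C \<and> w j - x j \<in> C" "v i = sum x J"
    using decompose_sum[OF assms(2), of w "v i"] insert by auto
  have "sum v I = (\<Sum>j\<in>J. w j - x j)"
    using \<open>sum w J - v i = sum v I\<close> x by (simp add: sum_subtractf)
  then obtain u where u: "\<forall>k\<in>I. \<forall>j\<in>J. u k j \<in> C" "\<forall>k\<in>I. v k = (\<Sum>j\<in>J. u k j)"
    "\<forall>j\<in>J. w j - x j = (\<Sum>k\<in>I. u k j)"
    using insert(3)[of "\<lambda>j. w j - x j"] insert(4) x by auto
  have "(\<Sum>k\<in>I. (u(i := x)) k j) = (\<Sum>k\<in>I. u k j)" for j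
    using insert(2) by (intro sum.cong) auto
  then show ?case
    using insert(1,2) u x by (intro exI[of _ "u(i := x)"]) (auto simp: algebra_simps)
qed

end

section \<open>The cone over a convex set, its faces and homogeneous extensions\<close>

lemma cone_overI: "0 \<le> c \<Longrightarrow> x \<in> K \<Longrightarrow> (c *\<^sub>R x, c) \<in> cone_over K"
  by (auto simp: cone_over_def)

lemma cone_overE:
  assumes "u \<in> cone_over K"
  obtains c x where "0 \<le> c" "x \<in> K" "u = (c *\<^sub>R x, c)"
  using assms by (auto simp: cone_over_def)

lemma zero_in_cone_over: "K \<noteq> {} \<Longrightarrow> 0 \<in> cone_over K"
  using cone_overI[of 0] by (fastforce simp: zero_prod_def)

lemma cone_over_add:
  assumes "convex K" "u \<in> cone_over K" "v \<in> cone_over K"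
  shows "u + v \<in> cone_over K"
proof -
  obtain a x where 1: "0 \<le> a" "x \<in> K" "u = (a *\<^sub>R x, a)" using assms(2) by (rule cone_overE)
  obtain b y where 2: "0 \<le> b" "y \<in> K" "v = (b *\<^sub>R y, b)" using assms(3) by (rule cone_overE)
  obtain z where "z \<in> K" "a *\<^sub>R x + b *\<^sub>R y = (a + b) *\<^sub>R z"
    by (rule convex_scaled_sum[OF assms(1) 1(2) 2(2) 1(1) 2(1)])
  then show ?thesis using 1 2 cone_overI[of "a + b" z K] by simp
qed

lemma choquet_simplex_riesz_cone:
  assumes "choquet_simplex K"
  shows "riesz_cone (cone_over K)"
proof
  show "u = 0" if "u \<in> cone_over K" "- u \<in> cone_over K" for u
    using that by (auto simp: cone_over_def zero_prod_def)
qed (use assms in \<open>auto simp: choquet_simplex_def zero_in_cone_over cone_over_add\<close>)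

text \<open>Divided by the height of \<open>v\<close>, the decomposition of \<open>v\<close> into
  \<open>u\<close> and \<open>v - u\<close> places a point of the face \<open>S\<close> between the
  base points of the two summands, so the face property captures the base point of
  \<open>u\<close>.\<close>

lemma cone_over_face_hereditary:
  assumes S: "S face_of K" and v: "v \<in> cone_over S" and u: "u \<in> cone_over K" "v - u \<in> cone_over K"
  shows "u \<in> cone_over S"
proof -
  obtain c x where 0: "0 \<le> c" "x \<in> S" "v = (c *\<^sub>R x, c)" using v by (rule cone_overE)
  obtain a y where 1: "0 \<le> a" "y \<in> K" "u = (a *\<^sub>R y, a)" using u(1) by (rule cone_overE)
  obtain b z where 2: "0 \<le> b" "z \<in> K" "v - u = (b *\<^sub>R z, b)" using u(2) by (rule cone_overE)
  have c: "c = a + b" "c *\<^sub>R x = a *\<^sub>R y + b *\<^sub>R z"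
    using 0 1 2 by (auto simp: algebra_simps)
  show ?thesis
  \<comment> \<open>These are the degenerate cases in which the point of \<open>S\<close> is not in
    the open segment, which requires positive weights and distinct ends.\<close>
  proof (cases "a = 0 \<or> b = 0 \<or> y = z")
    case True
    then consider "a = 0" | "b = 0" "a \<noteq> 0" | "y = z" "a \<noteq> 0" by blast
    then show ?thesis
    proof cases
      case 1
      then show ?thesis
        using \<open>u = (a *\<^sub>R y, a)\<close> zero_in_cone_over[of S] 0(2) by (auto simp: zero_prod_def)
    next
      case 2
      then have "u = v" using 0 1 c by simp
      then show ?thesis using v by simp
    next
      case 3
      then have "c *\<^sub>R x = c *\<^sub>R y" "c \<noteq> 0" using c 1 2 by (auto simp: scaleR_add_left)
      then have "x = y" by simp
      then show ?thesis using 0 1 cone_overI by metis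
    qed
  next
    case False
    then have "a > 0" "b > 0" using 1 2 by auto
    have "x = (1 / c) *\<^sub>R (c *\<^sub>R x)" using \<open>a > 0\<close> \<open>b > 0\<close> c(1) by simp
    also have "\<dots> = (a / c) *\<^sub>R y + (b / c) *\<^sub>R z"
      unfolding c(2) by (simp add: scaleR_add_right)
    also have "a / c = 1 - b / c"
      using \<open>a > 0\<close> \<open>b > 0\<close> c(1) by (simp add: field_simps)
    finally have "x \<in> open_segment y z"
      using False \<open>a > 0\<close> \<open>b > 0\<close> c(1) by (auto simp: in_segment intro!: exI[of _ "b / c"])
    then have "y \<in> S" using face_ofD[OF S _ 1(2) 2(2) 0(2)] by blast
    then show ?thesis using 1 cone_overI by metis
  qed
qed

text \<open>At the apex the junk value \<open>inverse 0\<close> is harmless, since it is multiplied by 0.\<close>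
definition cone_ext :: "('a::real_vector \<Rightarrow> real) \<Rightarrow> 'a \<times> real \<Rightarrow> real" where
  "cone_ext p u = snd u * p (inverse (snd u) *\<^sub>R fst u)"

lemma cone_ext_scaled: "cone_ext p (c *\<^sub>R x, c) = c * p x"
  by (cases "c = 0") (simp_all add: cone_ext_def)

lemma cone_ext_zero: "cone_ext p 0 = 0"
  by (simp add: cone_ext_def)

text \<open>The sum of two cone elements sits over a convex combination of their base points, with
  \<open>t\<close> the share of the second height; affineness thus turns into additivity.\<close>

lemma cone_ext_add:
  assumes p: "affine_fun_on S p" and u: "u \<in> cone_over S" and v: "v \<in> cone_over S"
  shows "cone_ext p (u + v) = cone_ext p u + cone_ext p v"
proof -
  obtain a x where 1: "0 \<le> a" "x \<in> S" "u = (a *\<^sub>R x, a)" using u by (rule cone_overE)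
  obtain b y where 2: "0 \<le> b" "y \<in> S" "v = (b *\<^sub>R y, b)" using v by (rule cone_overE)
  show ?thesis
  proof (cases "a + b = 0")
    case True
    then have "a = 0" "b = 0" using 1 2 by auto
    then show ?thesis using 1 2 by (simp add: cone_ext_def)
  next
    case False
    define t where "t = b / (a + b)"
    have t: "0 \<le> t" "t \<le> 1" "(a + b) * t = b" "(a + b) * (1 - t) = a"
      unfolding t_def using False 1 2 by (auto simp: field_simps)
    have "u + v = ((a + b) *\<^sub>R ((1 - t) *\<^sub>R x + t *\<^sub>R y), a + b)"
      using 1 2 t by (simp add: scaleR_add_right)
    then have "cone_ext p (u + v) = (a + b) * p ((1 - t) *\<^sub>R x + t *\<^sub>R y)"
      by (simp only: cone_ext_scaled)
    also have "p ((1 - t) *\<^sub>R x + t *\<^sub>R y) = (1 - t) * p x + t * p y"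
      using p 1 2 t by (simp add: affine_fun_on_def)
    also have "(a + b) * ((1 - t) * p x + t * p y) =
        ((a + b) * (1 - t)) * p x + ((a + b) * t) * p y"
      by (simp add: distrib_left)
    also have "\<dots> = cone_ext p u + cone_ext p v"
      by (simp only: t 1 2 cone_ext_scaled)
    finally show ?thesis .
  qed
qed

lemma cone_ext_sum:
  assumes "affine_fun_on S p" "convex S" "S \<noteq> {}" "\<And>i. i \<in> I \<Longrightarrow> u i \<in> cone_over S" "finite I"
  shows "cone_ext p (sum u I) = (\<Sum>i\<in>I. cone_ext p (u i))"
proof -
  have "sum u I \<in> cone_over S \<and> cone_ext p (sum u I) = (\<Sum>i\<in>I. cone_ext p (u i))"
    using assms(5,4)
    by (induct I rule: finite_induct)
      (auto simp: zero_in_cone_over cone_over_add cone_ext_add[OF assms(1)] cone_ext_zero assms(2,3))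
  then show ?thesis ..
qed

subsection \<open>Strict interpolation on a simplex\<close>

lemma in_A_const: "in_A K (\<lambda>_. c)"
  by (simp add: in_A_def affine_fun_on_def flip: distrib_right)

lemma in_A_add: "in_A K f \<Longrightarrow> in_A K g \<Longrightarrow> in_A K (\<lambda>x. f x + g x)"
  by (auto simp: in_A_def affine_fun_on_def ring_distribs mult_ac intro!: continuous_intros)

lemma in_A_cmult: "in_A K f \<Longrightarrow> in_A K (\<lambda>x. c * f x)"
  by (auto simp: in_A_def affine_fun_on_def ring_distribs mult_ac intro!: continuous_intros)

lemma in_A_diff: "in_A K f \<Longrightarrow> in_A K g \<Longrightarrow> in_A K (\<lambda>x. f x - g x)"
  by (auto simp: in_A_def affine_fun_on_def ring_distribs mult_ac intro!: continuous_intros)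

lemma in_A_sum: "(\<And>i. i \<in> I \<Longrightarrow> in_A K (f i)) \<Longrightarrow> in_A K (\<lambda>x. \<Sum>i\<in>I. f i x)"
  by (induct I rule: infinite_finite_induct) (auto simp: in_A_const in_A_add)

lemma in_A_bounded:
  assumes "compact K" "in_A K f"
  obtains M where "M > 0" "\<And>x. x \<in> K \<Longrightarrow> \<bar>f x\<bar> < M"
proof -
  have "bounded (f ` K)"
    using assms by (intro compact_imp_bounded compact_continuous_image) (auto simp: in_A_def)
  then obtain M where "M > 0" "\<forall>y\<in>f ` K. norm y \<le> M" by (auto simp: bounded_pos)
  then show ?thesis using that[of "M + 1"] by fastforce
qed

lemma in_A_family_bounded:
  assumes "finite I" and S: "\<And>i. i \<in> I \<Longrightarrow> compact (S i)" "\<And>i. i \<in> I \<Longrightarrow> in_A (S i) (p i)"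
  obtains N where "N > 0" "\<And>i x. i \<in> I \<Longrightarrow> x \<in> S i \<Longrightarrow> \<bar>p i x\<bar> < N"
proof -
  have "\<forall>i\<in>I. \<exists>M>0. \<forall>x\<in>S i. \<bar>p i x\<bar> < M"
    using in_A_bounded S by metis
  then obtain M where M: "\<And>i. i \<in> I \<Longrightarrow> M i > 0" "\<And>i x. i \<in> I \<Longrightarrow> x \<in> S i \<Longrightarrow> \<bar>p i x\<bar> < M i"
    by metis
  have le: "M i \<le> sum M I" if "i \<in> I" for i
    using that M(1) \<open>finite I\<close> by (intro member_le_sum) (auto simp: less_imp_le)
  have "0 \<le> sum M I" using M(1) by (intro sum_nonneg) (auto simp: less_imp_le)
  moreover have "\<bar>p i x\<bar> < 1 + sum M I" if "i \<in> I" "x \<in> S i" for i x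
    using M(2)[OF that] le[OF that(1)] by simp
  ultimately show thesis by (intro that[of "1 + sum M I"]) auto
qed

section \<open>Compactness of convex hulls of finite unions\<close>

lemma lctvs_compact_convex_hull_Un:
  fixes A B :: "'a::{real_vector,t2_space} set"
  assumes E: "lctvs TYPE('a)" and A: "compact A" "convex A" "A \<noteq> {}"
    and B: "compact B" "convex B" "B \<noteq> {}"
  shows "compact (convex hull (A \<union> B))"
proof -
  define g where "g = (\<lambda>z::real \<times> 'a \<times> 'a. (1 - fst z) *\<^sub>R fst (snd z) + fst z *\<^sub>R snd (snd z))"
  define S where "S b = (if b then A else B)" for b
  have "convex hull (A \<union> B) = convex hull (\<Union>(S ` UNIV))"
    by (auto simp: S_def UNIV_bool Un_commute)
  also have "\<dots> = {\<Sum>i\<in>UNIV. c i *\<^sub>R s i | c s.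
      (\<forall>i\<in>UNIV. c i \<ge> 0) \<and> sum c UNIV = 1 \<and> (\<forall>i\<in>UNIV. s i \<in> S i)}"
    using A B by (intro convex_hull_finite_union) (auto simp: S_def)
  \<comment> \<open>As \<open>A\<close> and \<open>B\<close> are convex, one point from each
    suffices, so the hull is a continuous image of a compact product. The index type of
    \<open>S\<close> is \<open>bool\<close> merely to write the pair as a finite family.\<close>
  also have "\<dots> = g ` ({0..1} \<times> A \<times> B)"
  proof (intro equalityI subsetI)
    fix x assume "x \<in> {\<Sum>i\<in>UNIV. c i *\<^sub>R s i | c s.
      (\<forall>i\<in>UNIV. c i \<ge> 0) \<and> sum c UNIV = 1 \<and> (\<forall>i\<in>UNIV. s i \<in> S i)}"
    then obtain c s where "x = (\<Sum>i\<in>UNIV. c i *\<^sub>R s i)" "\<forall>i\<in>UNIV. c i \<ge> 0" "sum c UNIV = 1"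
      "\<forall>i\<in>UNIV. s i \<in> S i"
      by blast
    then have cs: "c False \<ge> 0" "c True \<ge> 0" "c False + c True = 1" "s True \<in> A" "s False \<in> B"
      "x = c False *\<^sub>R s False + c True *\<^sub>R s True"
      by (simp_all add: UNIV_bool S_def)
    have "1 - c False = c True" using cs(3) by simp
    then have "x = g (c False, s True, s False)"
      using cs(6) by (simp add: g_def)
    then show "x \<in> g ` ({0..1} \<times> A \<times> B)"
      by (rule image_eqI) (use cs in auto)
  next
    fix x assume "x \<in> g ` ({0..1} \<times> A \<times> B)"
    then obtain t a b where t: "0 \<le> t" "t \<le> 1" "a \<in> A" "b \<in> B" "x = (1 - t) *\<^sub>R a + t *\<^sub>R b"
      by (auto simp: g_def)
    then show "x \<in> {\<Sum>i\<in>UNIV. c i *\<^sub>R s i | c s.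
      (\<forall>i\<in>UNIV. c i \<ge> 0) \<and> sum c UNIV = 1 \<and> (\<forall>i\<in>UNIV. s i \<in> S i)}"
      by (intro CollectI exI[of _ "\<lambda>i. if i then 1 - t else t"] exI[of _ "\<lambda>i. if i then a else b"])
        (auto simp: S_def UNIV_bool)
  qed
  also have "compact \<dots>"
    unfolding g_def using A B
    by (intro compact_continuous_image compact_Times lctvs_continuous_on_add[OF E]
        lctvs_continuous_on_scaleR[OF E]) (auto intro!: continuous_intros)
  finally show ?thesis .
qed

lemma lctvs_compact_convex_hull_UN:
  fixes A :: "'i \<Rightarrow> 'a::{real_vector,t2_space} set"
  assumes E: "lctvs TYPE('a)" and I: "finite I"
    and A: "\<And>i. i \<in> I \<Longrightarrow> compact (A i)" "\<And>i. i \<in> I \<Longrightarrow> convex (A i)" "\<And>i. i \<in> I \<Longrightarrow> A i \<noteq> {}"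
  shows "compact (convex hull (\<Union>(A ` I)))"
  using I A
proof (induct I rule: finite_induct)
  case empty
  then show ?case by simp
next
  case (insert i I)
  show ?case
  proof (cases "I = {}")
    case True
    then show ?thesis using insert by (simp add: hull_same)
  next
    case False
    have "convex hull (\<Union>(A ` insert i I)) = convex hull (A i \<union> convex hull (\<Union>(A ` I)))"
      by (simp flip: hull_Un_right)
    also have "compact \<dots>"
      using insert False by (intro lctvs_compact_convex_hull_Un[OF E]) auto
    finally show ?thesis .
  qed
qed

text \<open>Each constraint carries its own face, so that conditions on \<open>F\<close> and
  conditions on the whole simplex, which is a face of itself, can be imposed at once.\<close>

definition face_functions :: "'a::{real_vector,topological_space} set \<Rightarrow> ('a set \<times> ('a \<Rightarrow> real)) set \<Rightarrow> bool" where
  "face_functions K P \<longleftrightarrow> finite P \<and>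
    (\<forall>(S, p)\<in>P. S face_of K \<and> closed S \<and> S \<noteq> {} \<and> in_A S p)"

lemma face_functionsD:
  assumes "face_functions K P" "(S, p) \<in> P"
  shows "S face_of K" "closed S" "S \<noteq> {}" "in_A S p" "convex S" "S \<subseteq> K"
proof -
  show "S face_of K" "closed S" "S \<noteq> {}" "in_A S p"
    using assms by (auto simp: face_functions_def)
  then show "convex S" "S \<subseteq> K" by (auto simp: face_of_def)
qed

lemma face_functions_finite: "face_functions K P \<Longrightarrow> finite P"
  by (simp add: face_functions_def)

definition graph_hull :: "('a::real_vector set \<times> ('a \<Rightarrow> real)) set \<Rightarrow> ('a \<times> real) set" where
  "graph_hull P = convex hull (\<Union>i\<in>P. (\<lambda>x. (x, snd i x)) ` fst i)"

lemma graph_in_graph_hull: "(S, p) \<in> P \<Longrightarrow> x \<in> S \<Longrightarrow> (x, p x) \<in> graph_hull P"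
  unfolding graph_hull_def by (intro hull_inc) force

lemma convex_graph:
  assumes "affine_fun_on S p" "convex S"
  shows "convex ((\<lambda>x. (x, p x)) ` S)"
proof (rule convexI)
  fix y z and u v :: real
  assume y: "y \<in> (\<lambda>x. (x, p x)) ` S" and z: "z \<in> (\<lambda>x. (x, p x)) ` S" and uv: "0 \<le> u" "0 \<le> v" "u + v = 1"
  obtain a b where ab: "a \<in> S" "b \<in> S" "y = (a, p a)" "z = (b, p b)" using y z by auto
  have u: "u = 1 - v" using uv by simp
  have "p (u *\<^sub>R a + v *\<^sub>R b) = u * p a + v * p b"
    using assms(1) ab uv unfolding u affine_fun_on_def by simp
  moreover have "u *\<^sub>R a + v *\<^sub>R b \<in> S" using assms(2) ab uv by (simp add: convexD)
  ultimately show "u *\<^sub>R y + v *\<^sub>R z \<in> (\<lambda>x. (x, p x)) ` S"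
    using ab by (intro rev_image_eqI[of "u *\<^sub>R a + v *\<^sub>R b"]) auto
qed

lemma compact_graph_hull:
  fixes K :: "'a::{real_vector,t2_space} set"
  assumes E: "lctvs TYPE('a)" and "compact K" and P: "face_functions K P"
  shows "compact (graph_hull P)"
  unfolding graph_hull_def
proof (rule lctvs_compact_convex_hull_UN[OF lctvs_prod_real[OF E] face_functions_finite[OF P]])
  fix i assume i: "i \<in> P"
  then have f: "(fst i, snd i) \<in> P" by simp
  note f = face_functionsD[OF P f]
  have "compact (fst i)"
    using compact_Int_closed[OF \<open>compact K\<close> f(2)] f(6) by (simp add: Int_absorb1)
  then show "compact ((\<lambda>x. (x, snd i x)) ` fst i)"
    using f(4) by (intro compact_continuous_image continuous_on_Pair) (auto simp: in_A_def)
  show "convex ((\<lambda>x. (x, snd i x)) ` fst i)"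
    using f by (intro convex_graph) (auto simp: in_A_def)
  show "(\<lambda>x. (x, snd i x)) ` fst i \<noteq> {}" using f by simp
qed

text \<open>The weights of a convex combination become heights in the cone. The point
  \<open>x\<close> is thereby lifted to \<open>(x, 1)\<close>, a sum to which Riesz decomposition
  applies, and the value \<open>t\<close> to a sum of additive functions of the summands.\<close>

lemma graph_hull_cone_decomposition:
  assumes P: "face_functions K P" and z: "(x, t) \<in> graph_hull P"
  obtains v where "\<And>i. i \<in> P \<Longrightarrow> v i \<in> cone_over (fst i)" "sum v P = (x, 1)"
    "(\<Sum>i\<in>P. cone_ext (snd i) (v i)) = t"
proof -
  define G where "G i = (\<lambda>x. (x, snd i x)) ` fst i" for i :: "'a set \<times> ('a \<Rightarrow> real)"
  have "convex (G i) \<and> G i \<noteq> {}" if "i \<in> P" for i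
    using face_functionsD[OF P, of "fst i" "snd i"] that
    by (auto simp: G_def in_A_def intro: convex_graph)
  then have "graph_hull P = {\<Sum>i\<in>P. c i *\<^sub>R s i | c s.
      (\<forall>i\<in>P. c i \<ge> 0) \<and> sum c P = 1 \<and> (\<forall>i\<in>P. s i \<in> G i)}"
    unfolding graph_hull_def G_def[symmetric]
    by (intro convex_hull_finite_union face_functions_finite[OF P]) auto
  then obtain c s where cs: "\<forall>i\<in>P. c i \<ge> 0" "sum c P = 1" "\<forall>i\<in>P. s i \<in> G i"
    "(x, t) = (\<Sum>i\<in>P. c i *\<^sub>R s i)"
    using z by auto
  have s: "fst (s i) \<in> fst i" "snd (s i) = snd i (fst (s i))" if "i \<in> P" for i
    using cs(3) that by (auto simp: G_def)
  show thesis
  proof (rule that[of "\<lambda>i. (c i *\<^sub>R fst (s i), c i)"])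
    show "(c i *\<^sub>R fst (s i), c i) \<in> cone_over (fst i)" if "i \<in> P" for i
      using cone_overI[OF _ s(1)[OF that]] cs(1) that by blast
    have "x = (\<Sum>i\<in>P. c i *\<^sub>R fst (s i))"
      using arg_cong[OF cs(4), of fst] by (simp add: fst_sum)
    then show "(\<Sum>i\<in>P. (c i *\<^sub>R fst (s i), c i)) = (x, 1)"
      using cs(2) by (simp add: prod_eq_iff fst_sum snd_sum)
    have "t = (\<Sum>i\<in>P. c i * snd (s i))"
      using arg_cong[OF cs(4), of snd] by (simp add: snd_sum)
    then show "(\<Sum>i\<in>P. cone_ext (snd i) (c i *\<^sub>R fst (s i), c i)) = t"
      using s(2) by (simp add: cone_ext_scaled)
  qed
qed

text \<open>A nonzero cone element has positive height, so its base point is unique and lies in both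
  \<open>S\<close> and \<open>T\<close>.\<close>

lemma cone_ext_less:
  assumes "u \<in> cone_over S" "u \<in> cone_over T" "u \<noteq> 0" "\<And>x. x \<in> S \<Longrightarrow> x \<in> T \<Longrightarrow> p x < q x"
  shows "cone_ext p u < cone_ext q u"
proof -
  obtain c x where 1: "0 \<le> c" "x \<in> S" "u = (c *\<^sub>R x, c)" using assms(1) by (rule cone_overE)
  obtain d y where 2: "0 \<le> d" "y \<in> T" "u = (d *\<^sub>R y, d)" using assms(2) by (rule cone_overE)
  have "c \<noteq> 0" using 1(3) assms(3) by (auto simp: zero_prod_def)
  have "d = c" "d *\<^sub>R y = c *\<^sub>R x" using 1(3) 2(3) by (metis Pair_inject)+
  with \<open>c \<noteq> 0\<close> have "x = y" by simp
  then show ?thesis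
    using assms(4)[OF 1(2)] 2(2) 1(1) \<open>c \<noteq> 0\<close> unfolding 1(3) cone_ext_scaled by simp
qed

text \<open>A common point of the two hulls has two decompositions in the lattice cone; on a common
  refinement the lower functions are strictly smaller than the upper ones.\<close>
lemma graph_hulls_disjoint:
  fixes K :: "'a::{real_vector,t2_space} set"
  assumes K: "choquet_simplex K" and P: "face_functions K P" and Q: "face_functions K Q"
    and less: "\<And>S p T q x. (S, p) \<in> P \<Longrightarrow> (T, q) \<in> Q \<Longrightarrow> x \<in> S \<Longrightarrow> x \<in> T \<Longrightarrow> p x < q x"
  shows "graph_hull P \<inter> graph_hull Q = {}"
proof (rule ccontr)
  assume "\<not> ?thesis"
  then obtain x t where z: "(x, t) \<in> graph_hull P" "(x, t) \<in> graph_hull Q" by auto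
  interpret riesz_cone "cone_over K" by (rule choquet_simplex_riesz_cone[OF K])
  obtain v where v: "\<And>i. i \<in> P \<Longrightarrow> v i \<in> cone_over (fst i)" "sum v P = (x, 1)"
    "(\<Sum>i\<in>P. cone_ext (snd i) (v i)) = t"
    by (rule graph_hull_cone_decomposition[OF P z(1)]) blast
  obtain w where w: "\<And>j. j \<in> Q \<Longrightarrow> w j \<in> cone_over (fst j)" "sum w Q = (x, 1)"
    "(\<Sum>j\<in>Q. cone_ext (snd j) (w j)) = t"
    by (rule graph_hull_cone_decomposition[OF Q z(2)]) blast
  note fin = face_functions_finite[OF P] face_functions_finite[OF Q]
  have mono: "cone_over S \<subseteq> cone_over K" if "S \<subseteq> K" for S
    using that by (auto simp: cone_over_def)
  have vK: "v i \<in> cone_over K" if "i \<in> P" for i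
    using v(1)[OF that] mono face_functionsD(6)[OF P, of "fst i" "snd i"] that by auto
  have wK: "w j \<in> cone_over K" if "j \<in> Q" for j
    using w(1)[OF that] mono face_functionsD(6)[OF Q, of "fst j" "snd j"] that by auto
  have "\<exists>u. (\<forall>i\<in>P. \<forall>j\<in>Q. u i j \<in> cone_over K) \<and> (\<forall>i\<in>P. v i = (\<Sum>j\<in>Q. u i j)) \<and>
    (\<forall>j\<in>Q. w j = (\<Sum>i\<in>P. u i j))"
    by (rule common_refinement[OF fin vK wK]) (simp_all add: v(2) w(2))
  then obtain u where u: "\<And>i j. i \<in> P \<Longrightarrow> j \<in> Q \<Longrightarrow> u i j \<in> cone_over K"
    "\<And>i. i \<in> P \<Longrightarrow> v i = (\<Sum>j\<in>Q. u i j)" "\<And>j. j \<in> Q \<Longrightarrow> w j = (\<Sum>i\<in>P. u i j)"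
    by blast
  \<comment> \<open>A piece is dominated by the element it was cut from and so stays over the face
    of that element. Together with \<open>uQ\<close> every piece lies over both faces, the only
    place where \<open>less\<close> compares the two functions.\<close>
  have uP: "u i j \<in> cone_over (fst i)" if "i \<in> P" "j \<in> Q" for i j
  proof (rule cone_over_face_hereditary)
    show "fst i face_of K" using face_functionsD(1)[OF P, of "fst i" "snd i"] that by simp
    have "v i - u i j = (\<Sum>k\<in>Q - {j}. u i k)"
      using that u(2) sum.remove[OF fin(2) that(2), of "u i"] by simp
    moreover have "\<dots> \<in> cone_over K" by (rule sum_mem) (use u(1) that in blast)
    ultimately show "v i - u i j \<in> cone_over K" by simp
  qed (use u that v in auto)
  have uQ: "u i j \<in> cone_over (fst j)" if "i \<in> P" "j \<in> Q" for i j
  proof (rule cone_over_face_hereditary)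
    show "fst j face_of K" using face_functionsD(1)[OF Q, of "fst j" "snd j"] that by simp
    have "w j - u i j = (\<Sum>k\<in>P - {i}. u k j)"
      using that u(3) sum.remove[OF fin(1) that(1), of "\<lambda>k. u k j"] by simp
    moreover have "\<dots> \<in> cone_over K" by (rule sum_mem) (use u(1) that in blast)
    ultimately show "w j - u i j \<in> cone_over K" by simp
  qed (use u that w in auto)
  have "cone_ext (snd i) (v i) = (\<Sum>j\<in>Q. cone_ext (snd i) (u i j))" if "i \<in> P" for i
    using face_functionsD[OF P, of "fst i" "snd i"] that uP fin u(2)
    by (simp add: cone_ext_sum[of "fst i"] in_A_def)
  then have tP: "t = (\<Sum>i\<in>P. \<Sum>j\<in>Q. cone_ext (snd i) (u i j))"
    using v(3) by simp
  have "cone_ext (snd j) (w j) = (\<Sum>i\<in>P. cone_ext (snd j) (u i j))" if "j \<in> Q" for j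
    using face_functionsD[OF Q, of "fst j" "snd j"] that uQ fin u(3)
    by (simp add: cone_ext_sum[of "fst j"] in_A_def)
  then have tQ: "t = (\<Sum>i\<in>P. \<Sum>j\<in>Q. cone_ext (snd j) (u i j))"
    using w(3) by (subst sum.swap) simp
  have lt: "cone_ext (snd i) (u i j) < cone_ext (snd j) (u i j)" if "i \<in> P" "j \<in> Q" "u i j \<noteq> 0" for i j
    using uP[OF that(1,2)] uQ[OF that(1,2)] that(3)
  proof (rule cone_ext_less)
    fix x assume "x \<in> fst i" "x \<in> fst j"
    then show "snd i x < snd j x" using less[of "fst i" "snd i" "fst j" "snd j" x] that by simp
  qed
  have le: "cone_ext (snd i) (u i j) \<le> cone_ext (snd j) (u i j)" if "i \<in> P" "j \<in> Q" for i j
    using lt[OF that] by (cases "u i j = 0") (auto simp: cone_ext_zero)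
  \<comment> \<open>A strict inequality between the totals needs one nonzero piece; all pieces
    together have height 1.\<close>
  have "\<exists>i\<in>P. \<exists>j\<in>Q. u i j \<noteq> 0"
  proof (rule ccontr)
    assume "\<not> ?thesis"
    then have "sum v P = 0" using u(2) by simp
    then show False using v(2) by (simp add: zero_prod_def)
  qed
  then obtain i j where ij: "i \<in> P" "j \<in> Q" "u i j \<noteq> 0" by blast
  have "(\<Sum>j\<in>Q. cone_ext (snd i) (u i j)) < (\<Sum>j\<in>Q. cone_ext (snd j) (u i j))"
    using fin(2) le[OF ij(1)] lt[OF ij] ij(2) by (intro sum_strict_mono_ex1) blast+
  then have "(\<Sum>i\<in>P. \<Sum>j\<in>Q. cone_ext (snd i) (u i j)) < (\<Sum>i\<in>P. \<Sum>j\<in>Q. cone_ext (snd j) (u i j))"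
    using fin(1) ij(1) by (intro sum_strict_mono_ex1) (blast intro: sum_mono le)+
  then show False using tP tQ by simp
qed

text \<open>The two members over all of \<open>K\<close> give each hull a point above the same
  \<open>x0\<close>, the lower one in \<open>graph_hull P\<close>. So the hulls are nonempty, and
  the separating functional increases in the vertical direction.\<close>

lemma strict_interpolation_bounded:
  fixes K :: "'a::{real_vector,t2_space} set"
  assumes E: "lctvs TYPE('a)" and K: "choquet_simplex K"
    and P: "face_functions K P" and Q: "face_functions K Q"
    and KP: "(K, p0) \<in> P" and KQ: "(K, q0) \<in> Q"
    and less: "\<And>S p T q x. (S, p) \<in> P \<Longrightarrow> (T, q) \<in> Q \<Longrightarrow> x \<in> S \<Longrightarrow> x \<in> T \<Longrightarrow> p x < q x"
  obtains h where "in_A K h" "\<And>S p x. (S, p) \<in> P \<Longrightarrow> x \<in> S \<Longrightarrow> p x < h x"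
    "\<And>S q x. (S, q) \<in> Q \<Longrightarrow> x \<in> S \<Longrightarrow> h x < q x"
proof -
  have "compact K" using K by (simp add: choquet_simplex_def)
  note cpt = compact_graph_hull[OF E this P] compact_graph_hull[OF E this Q]
  define D where "D = (\<lambda>z. snd z - fst z) ` (graph_hull P \<times> graph_hull Q)"
  have D_I: "b - a \<in> D" if "a \<in> graph_hull P" "b \<in> graph_hull Q" for a b
    unfolding D_def using that by force
  obtain x0 where x0: "x0 \<in> K" using K by (auto simp: choquet_simplex_def)
  note hP = graph_in_graph_hull[OF KP x0] and hQ = graph_in_graph_hull[OF KQ x0]
  have disj: "graph_hull P \<inter> graph_hull Q = {}"
    by (rule graph_hulls_disjoint[OF K P Q]) (rule less)
  have "compact D"
    unfolding D_def using cpt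
    by (intro compact_continuous_image compact_Times lctvs_continuous_on_diff[OF lctvs_prod_real[OF E]])
      (auto intro!: continuous_intros)
  moreover have "convex D"
  proof -
    have "D = (\<Union>b\<in>graph_hull Q. \<Union>a\<in>graph_hull P. {b - a})" unfolding D_def by force
    then show ?thesis by (simp add: convex_differences graph_hull_def)
  qed
  moreover have "D \<noteq> {}" using hP hQ D_I by blast
  moreover have "0 \<notin> D"
  proof
    assume "0 \<in> D"
    then obtain z where "z \<in> graph_hull P \<times> graph_hull Q" "0 = snd z - fst z"
      unfolding D_def by (rule imageE) simp
    then have "snd z \<in> graph_hull P \<inter> graph_hull Q" by (simp add: mem_Times_iff)
    then show False
      using disj by blast
  qed
  ultimately obtain l :: "'a \<times> real \<Rightarrow> real" where l: "linear l" "continuous_on UNIV l" "\<And>d. d \<in> D \<Longrightarrow> l d > 0"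
    using lctvs_separate_zero[OF lctvs_prod_real[OF E], of D] by blast
  \<comment> \<open>By compactness the extreme values of \<open>l\<close> on the hulls are attained,
    so positivity on differences leaves a genuine gap for the level \<open>c\<close>.\<close>
  obtain a where a: "a \<in> graph_hull P" "\<And>a'. a' \<in> graph_hull P \<Longrightarrow> l a' \<le> l a"
    using continuous_attains_sup[OF cpt(1) _ continuous_on_subset[OF l(2)]] hP by blast
  obtain b where b: "b \<in> graph_hull Q" "\<And>b'. b' \<in> graph_hull Q \<Longrightarrow> l b \<le> l b'"
    using continuous_attains_inf[OF cpt(2) _ continuous_on_subset[OF l(2)]] hQ by blast
  have "l a < l b" using l(3)[OF D_I[OF a(1) b(1)]] by (simp add: linear_diff[OF l(1)])
  then obtain c where c: "l a < c" "c < l b" using dense by blast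
  define \<tau> where "\<tau> = l (0, 1)"
  have l_eq: "l (x, t) = l (x, 0) + t * \<tau>" for x t
  proof -
    have "(x, t) = (x, 0) + t *\<^sub>R (0, 1)" by simp
    then show ?thesis unfolding \<tau>_def by (metis linear_add[OF l(1)] linear_scale[OF l(1)] real_scaleR_def)
  qed
  have "p0 x0 < q0 x0" using less[OF KP KQ x0 x0] .
  moreover have "l ((x0, q0 x0) - (x0, p0 x0)) > 0" using l(3)[OF D_I[OF hP hQ]] .
  then have "(q0 x0 - p0 x0) * \<tau> > 0"
    unfolding linear_diff[OF l(1)] l_eq[of x0 "q0 x0"] l_eq[of x0 "p0 x0"] by (simp add: algebra_simps)
  ultimately have \<tau>: "\<tau> > 0" by (simp add: zero_less_mult_iff)
  show thesis
  \<comment> \<open>The interpolating \<open>h\<close> solves \<open>l (x, h x) = c\<close>: its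
    graph is the level set of the functional over \<open>K\<close>.\<close>
  proof (rule that[of "\<lambda>x. (c - l (x, 0)) / \<tau>"])
    have "continuous_on K (\<lambda>x. l (x, 0))"
      by (rule continuous_on_compose2[OF l(2)]) (auto intro!: continuous_intros)
    moreover have "l (((1 - t) *\<^sub>R x + t *\<^sub>R y), 0) = (1 - t) * l (x, 0) + t * l (y, 0)" for t x y
    proof -
      have "(((1 - t) *\<^sub>R x + t *\<^sub>R y), 0) = (1 - t) *\<^sub>R (x, 0) + t *\<^sub>R (y, 0::real)" by simp
      then show ?thesis by (metis linear_add[OF l(1)] linear_scale[OF l(1)] real_scaleR_def)
    qed
    ultimately have "in_A K (\<lambda>x. l (x, 0))"
      by (simp add: in_A_def affine_fun_on_def)
    from in_A_cmult[OF in_A_diff[OF in_A_const this], of "1 / \<tau>" c]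
    show "in_A K (\<lambda>x. (c - l (x, 0)) / \<tau>)" by simp
  next
    fix S p x assume "(S, p) \<in> P" "x \<in> S"
    then have "l (x, p x) < c" using a(2) c(1) graph_in_graph_hull by fastforce
    then show "p x < (c - l (x, 0)) / \<tau>"
      using \<tau> unfolding l_eq[of x "p x"] by (simp add: field_simps)
  next
    fix S q x assume "(S, q) \<in> Q" "x \<in> S"
    then have "c < l (x, q x)" using b(2) c(2) graph_in_graph_hull by fastforce
    then show "(c - l (x, 0)) / \<tau> < q x"
      using \<tau> unfolding l_eq[of x "q x"] by (simp add: field_simps)
  qed
qed

text \<open>Adding the constants \<open>- N\<close> and \<open>N\<close> over \<open>K\<close>, with
  \<open>N\<close> beyond all values that occur, reduces this to the bounded case without creating
  new conflicts.\<close>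

theorem strict_interpolation:
  fixes K :: "'a::{real_vector,t2_space} set"
  assumes E: "lctvs TYPE('a)" and K: "choquet_simplex K"
    and P: "face_functions K P" and Q: "face_functions K Q"
    and less: "\<And>S p T q x. (S, p) \<in> P \<Longrightarrow> (T, q) \<in> Q \<Longrightarrow> x \<in> S \<Longrightarrow> x \<in> T \<Longrightarrow> p x < q x"
  obtains h where "in_A K h" "\<And>S p x. (S, p) \<in> P \<Longrightarrow> x \<in> S \<Longrightarrow> p x < h x"
    "\<And>S q x. (S, q) \<in> Q \<Longrightarrow> x \<in> S \<Longrightarrow> h x < q x"
proof -
  have cK: "compact K" and "convex K" "K \<noteq> {}" using K by (auto simp: choquet_simplex_def)
  have fin: "finite (P \<union> Q)" using P Q by (auto dest: face_functions_finite)
  have PQ: "compact (fst i)" "in_A (fst i) (snd i)" if "i \<in> P \<union> Q" for i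
  proof -
    have i: "fst i \<subseteq> K" "closed (fst i)" "in_A (fst i) (snd i)"
      using that face_functionsD[OF P, of "fst i" "snd i"] face_functionsD[OF Q, of "fst i" "snd i"] by auto
    then show "compact (fst i)" "in_A (fst i) (snd i)"
      using compact_Int_closed[OF cK] by (metis Int_absorb1)+
  qed
  obtain N where N: "N > 0" and bound: "\<And>i x. i \<in> P \<union> Q \<Longrightarrow> x \<in> fst i \<Longrightarrow> \<bar>snd i x\<bar> < N"
    using in_A_family_bounded[of "P \<union> Q" fst snd] fin PQ by blast
  have const: "face_functions K (insert (K, \<lambda>_. c) R)" if "face_functions K R" for c R
    using that \<open>convex K\<close> \<open>K \<noteq> {}\<close> compact_imp_closed[OF cK]
    by (auto simp: face_functions_def in_A_const face_of_refl)
  obtain h where h: "in_A K h" "\<And>S p x. (S, p) \<in> insert (K, \<lambda>_. - N) P \<Longrightarrow> x \<in> S \<Longrightarrow> p x < h x"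
    "\<And>S q x. (S, q) \<in> insert (K, \<lambda>_. N) Q \<Longrightarrow> x \<in> S \<Longrightarrow> h x < q x"
  proof (rule strict_interpolation_bounded[OF E K const[OF P, of "- N"] const[OF Q, of N]])
    fix S p T q x
    assume "(S, p) \<in> insert (K, \<lambda>_. - N) P" "(T, q) \<in> insert (K, \<lambda>_. N) Q" "x \<in> S" "x \<in> T"
    moreover have "\<bar>p x\<bar> < N" if "(S, p) \<in> P" using bound[of "(S, p)" x] that \<open>x \<in> S\<close> by simp
    moreover have "\<bar>q x\<bar> < N" if "(T, q) \<in> Q" using bound[of "(T, q)" x] that \<open>x \<in> T\<close> by simp
    ultimately show "p x < q x" using less N by fastforce
  qed auto
  show thesis by (rule that[of h]) (use h in blast)+
qed

subsection \<open>Affine partitions of unity\<close>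

lemma in_A_strict_interpolation:
  fixes K :: "'a::{real_vector,t2_space} set"
  assumes E: "lctvs TYPE('a)" and K: "choquet_simplex K" and "finite P" "finite Q"
    and P: "\<And>p. p \<in> P \<Longrightarrow> in_A K p" and Q: "\<And>q. q \<in> Q \<Longrightarrow> in_A K q"
    and less: "\<And>p q x. p \<in> P \<Longrightarrow> q \<in> Q \<Longrightarrow> x \<in> K \<Longrightarrow> p x < q x"
  obtains h where "in_A K h" "\<And>p x. p \<in> P \<Longrightarrow> x \<in> K \<Longrightarrow> p x < h x"
    "\<And>q x. q \<in> Q \<Longrightarrow> x \<in> K \<Longrightarrow> h x < q x"
proof -
  have K': "K face_of K" "closed K" "K \<noteq> {}"
    using K by (auto simp: choquet_simplex_def face_of_refl compact_imp_closed)
  have "face_functions K (Pair K ` R)" if "finite R" "\<And>p. p \<in> R \<Longrightarrow> in_A K p" for R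
    using that K' by (auto simp: face_functions_def)
  then have faces: "face_functions K (Pair K ` P)" "face_functions K (Pair K ` Q)"
    using assms by blast+
  obtain h where h: "in_A K h" "\<And>S p x. (S, p) \<in> Pair K ` P \<Longrightarrow> x \<in> S \<Longrightarrow> p x < h x"
    "\<And>S q x. (S, q) \<in> Pair K ` Q \<Longrightarrow> x \<in> S \<Longrightarrow> h x < q x"
    by (rule strict_interpolation[OF E K faces]) (use less in auto)
  show thesis
  proof (rule that[OF h(1)])
    show "p x < h x" if "p \<in> P" "x \<in> K" for p x using h(2)[of K p x] that by simp
    show "h x < q x" if "q \<in> Q" "x \<in> K" for q x using h(3)[of K q x] that by simp
  qed
qed

text \<open>Fourier--Motzkin elimination of the variables, with interpolation to recover each of them.\<close>
lemma strict_linear_system_solvable: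
  fixes K :: "'a::{real_vector,t2_space} set" and Cs :: "(('v \<Rightarrow> real) \<times> ('a \<Rightarrow> real)) set"
  assumes E: "lctvs TYPE('a)" and K: "choquet_simplex K"
    and "finite V" "finite Cs" "\<And>c b. (c, b) \<in> Cs \<Longrightarrow> in_A K b"
    and "\<And>x. x \<in> K \<Longrightarrow> \<exists>y. \<forall>(c, b)\<in>Cs. (\<Sum>v\<in>V. c v * y v) < b x"
  shows "\<exists>Y. (\<forall>v\<in>V. in_A K (Y v)) \<and> (\<forall>x\<in>K. \<forall>(c, b)\<in>Cs. (\<Sum>v\<in>V. c v * Y v x) < b x)"
  using assms(3-)
proof (induct V arbitrary: Cs rule: finite_induct)
  case empty
  then show ?case by fastforce
next
  case (insert w V)
  define Z where "Z = {i \<in> Cs. fst i w = 0}"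
  define Up where "Up = {i \<in> Cs. fst i w > 0}"
  define Lo where "Lo = {i \<in> Cs. fst i w < 0}"
  \<comment> \<open>Dividing a constraint by its coefficient of \<open>w\<close> turns it into an
    upper bound on the variable \<open>w\<close> for \<open>Up\<close> and, as the inequality flips,
    into a lower bound for \<open>Lo\<close>. In \<open>comb i j\<close> the variable has cancelled:
    it says that the lower bound \<open>j\<close> is below the upper bound \<open>i\<close>.\<close>
  define comb :: "('v \<Rightarrow> real) \<times> ('a \<Rightarrow> real) \<Rightarrow> ('v \<Rightarrow> real) \<times> ('a \<Rightarrow> real) \<Rightarrow> ('v \<Rightarrow> real) \<times> ('a \<Rightarrow> real)"
    where "comb i j = (\<lambda>v. (1 / fst i w) * fst i v - (1 / fst j w) * fst j v,
      \<lambda>x. (1 / fst i w) * snd i x - (1 / fst j w) * snd j x)" for i j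
  define bound where "bound i y x = (1 / fst i w) * (snd i x - (\<Sum>v\<in>V. fst i v * y v))"
    for i :: "('v \<Rightarrow> real) \<times> ('a \<Rightarrow> real)" and y x
  define Cs' where "Cs' = Z \<union> (\<lambda>(i, j). comb i j) ` (Up \<times> Lo)"
  have fin: "finite Z" "finite Up" "finite Lo" using insert by (auto simp: Z_def Up_def Lo_def)
  have Cs: "Cs = Z \<union> Up \<union> Lo" by (auto simp: Z_def Up_def Lo_def)
  have inA: "in_A K (snd i)" if "i \<in> Cs" for i
    using insert(5)[of "fst i" "snd i"] that by simp
  have comb_iff: "(\<Sum>v\<in>V. fst (comb i j) v * y v) < snd (comb i j) x \<longleftrightarrow> bound j y x < bound i y x"
    for i j y x
    by (simp add: comb_def bound_def left_diff_distrib right_diff_distrib sum_subtractf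
        sum_distrib_left mult.assoc sum_divide_distrib) linarith
  have Up_iff: "(\<Sum>v\<in>insert w V. fst i v * y v) < snd i x \<longleftrightarrow> y w < bound i y x" if "i \<in> Up" for i y x
    using that insert(1,2) by (auto simp: Up_def bound_def field_simps)
  have Lo_iff: "(\<Sum>v\<in>insert w V. fst i v * y v) < snd i x \<longleftrightarrow> bound i y x < y w" if "i \<in> Lo" for i y x
    using that insert(1,2) by (auto simp: Lo_def bound_def field_simps)
  have Z_iff: "(\<Sum>v\<in>insert w V. fst i v * y v) = (\<Sum>v\<in>V. fst i v * y v)" if "i \<in> Z" for i and y :: "'v \<Rightarrow> real"
    using that insert(1,2) by (simp add: Z_def)
  have "\<exists>Y. (\<forall>v\<in>V. in_A K (Y v)) \<and> (\<forall>x\<in>K. \<forall>(c, b)\<in>Cs'. (\<Sum>v\<in>V. c v * Y v x) < b x)"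
  proof (rule insert(3))
    show "finite Cs'" using fin by (simp add: Cs'_def)
  next
    fix c b assume "(c, b) \<in> Cs'"
    then consider "(c, b) \<in> Z" | i j where "i \<in> Up" "j \<in> Lo" "(c, b) = comb i j"
      by (auto simp: Cs'_def)
    then show "in_A K b"
    proof cases
      case 1
      then show ?thesis using insert(5) by (auto simp: Z_def)
    next
      case 2
      then have "in_A K (snd i)" "in_A K (snd j)" using inA Cs by auto
      moreover have "b = (\<lambda>x. (1 / fst i w) * snd i x - (1 / fst j w) * snd j x)"
        using 2(3) by (simp add: comb_def)
      ultimately show ?thesis by (simp only:) (intro in_A_diff in_A_cmult)
    qed
  next
    fix x assume "x \<in> K"
    then obtain y where y: "\<forall>(c, b)\<in>Cs. (\<Sum>v\<in>insert w V. c v * y v) < b x"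
      using insert(6) by blast
    then have y': "(\<Sum>v\<in>insert w V. fst i v * y v) < snd i x" if "i \<in> Cs" for i
      using that by (auto simp: case_prod_beta)
    have "(\<Sum>v\<in>V. fst k v * y v) < snd k x" if k: "k \<in> Cs'" for k
    proof -
      consider "k \<in> Z" | i j where "i \<in> Up" "j \<in> Lo" "k = comb i j"
        using k by (auto simp: Cs'_def)
      then show ?thesis
      proof cases
        case 1
        then show ?thesis using y'[of k] Z_iff[of k y] Cs by auto
      next
        case 2
        have "bound j y x < y w" using y'[of j] Lo_iff[OF 2(2)] Cs 2(2) by blast
        moreover have "y w < bound i y x" using y'[of i] Up_iff[OF 2(1)] Cs 2(1) by blast
        ultimately show ?thesis using comb_iff[of i j y x] 2(3) by simp
      qed
    qed
    then show "\<exists>y. \<forall>(c, b)\<in>Cs'. (\<Sum>v\<in>V. c v * y v) < b x"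
      by (intro exI[of _ y]) auto
  qed
  then obtain Y where Y: "\<forall>v\<in>V. in_A K (Y v)" "\<forall>x\<in>K. \<forall>(c, b)\<in>Cs'. (\<Sum>v\<in>V. c v * Y v x) < b x"
    by blast
  \<comment> \<open>Once the other variables are affine functions, the bounds on \<open>w\<close>
    are themselves in A(K), and the eliminated constraints say that they can be
    interpolated.\<close>
  define B where "B i x = bound i (\<lambda>v. Y v x) x" for i x
  have B_in: "in_A K (B i)" if "i \<in> Cs" for i
    unfolding B_def bound_def using Y(1) inA[OF that]
    by (intro in_A_cmult in_A_diff in_A_sum) auto
  have B_less: "B j x < B i x" if "i \<in> Up" "j \<in> Lo" "x \<in> K" for i j x
  proof -
    have "comb i j \<in> Cs'" using that by (auto simp: Cs'_def)
    then have "(\<Sum>v\<in>V. fst (comb i j) v * Y v x) < snd (comb i j) x"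
      using Y(2) that(3) by (auto simp: case_prod_beta)
    then show ?thesis unfolding B_def using comb_iff[of i j "\<lambda>v. Y v x" x] by simp
  qed
  \<comment> \<open>Either family may be empty here, so a variable bounded on one side only, or not
    at all, is recovered in the same way.\<close>
  obtain h where h: "in_A K h" "\<And>p x. p \<in> B ` Lo \<Longrightarrow> x \<in> K \<Longrightarrow> p x < h x"
    "\<And>q x. q \<in> B ` Up \<Longrightarrow> x \<in> K \<Longrightarrow> h x < q x"
  proof (rule in_A_strict_interpolation[OF E K, of "B ` Lo" "B ` Up"])
    show "finite (B ` Lo)" "finite (B ` Up)" using fin by auto
    show "in_A K p" if "p \<in> B ` Lo" for p using that B_in Cs by auto
    show "in_A K p" if "p \<in> B ` Up" for p using that B_in Cs by auto
    show "p x < q x" if "p \<in> B ` Lo" "q \<in> B ` Up" "x \<in> K" for p q x using that B_less by auto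
  qed blast
  define Y' where "Y' = Y(w := h)"
  have Y': "Y' w = h" "\<And>v. v \<in> V \<Longrightarrow> Y' v = Y v" using insert(2) by (auto simp: Y'_def)
  have boundY': "bound i (\<lambda>v. Y' v x) x = B i x" for i x
    unfolding B_def bound_def using Y'(2) by simp
  have "(\<Sum>v\<in>insert w V. fst k v * Y' v x) < snd k x" if k: "k \<in> Cs" and x: "x \<in> K" for k x
  proof -
    consider "k \<in> Z" | "k \<in> Up" | "k \<in> Lo" using k Cs by blast
    then show ?thesis
    proof cases
      case 1
      then have "k \<in> Cs'" by (simp add: Cs'_def)
      then have "(\<Sum>v\<in>V. fst k v * Y v x) < snd k x"
        using Y(2) x by (auto simp: case_prod_beta)
      then show ?thesis using Z_iff[OF 1, of "\<lambda>v. Y' v x"] Y'(2) by simp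
    next
      case 2
      then have "h x < B k x" using h(3) x by blast
      then show ?thesis using Up_iff[OF 2, of "\<lambda>v. Y' v x" x] boundY' Y'(1) by simp
    next
      case 3
      then have "B k x < h x" using h(2) x by blast
      then show ?thesis using Lo_iff[OF 3, of "\<lambda>v. Y' v x" x] boundY' Y'(1) by simp
    qed
  qed
  then show ?case
    using Y(1) Y' h(1) by (intro exI[of _ Y']) auto
qed

text \<open>Closeness is left as a relation \<open>R\<close> because it is used in two senses:
  agreement of finitely many functions at two points, and uniform closeness of two values in
  A(K).\<close>

lemma compact_finite_net:
  assumes "compact S" "\<And>a. a \<in> S \<Longrightarrow> \<exists>U. open U \<and> a \<in> U \<and> (\<forall>b\<in>S \<inter> U. R a b)"
  obtains T where "finite T" "T \<subseteq> S" "\<And>b. b \<in> S \<Longrightarrow> \<exists>a\<in>T. R a b"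
proof -
  obtain U where U: "\<And>a. a \<in> S \<Longrightarrow> open (U a) \<and> a \<in> U a \<and> (\<forall>b\<in>S \<inter> U a. R a b)"
    using assms(2) by metis
  obtain T where "T \<subseteq> S" "finite T" "S \<subseteq> (\<Union>a\<in>T. U a)"
    using compactE_image[OF assms(1), of S U] U by blast
  then show thesis using U by (intro that[of T]) blast+
qed

lemma finite_continuous_nbhd:
  fixes h :: "'i \<Rightarrow> 'a::topological_space \<Rightarrow> real"
  assumes "finite I" "\<And>i. i \<in> I \<Longrightarrow> continuous_on K (h i)" "a \<in> K" "e > 0"
  shows "\<exists>U. open U \<and> a \<in> U \<and> (\<forall>b\<in>K \<inter> U. \<forall>i\<in>I. \<bar>h i b - h i a\<bar> < e)"
proof -
  have "\<forall>\<^sub>F b in at a within K. \<forall>i\<in>I. dist (h i b) (h i a) < e"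
    using assms by (intro eventually_ball_finite ballI tendstoD) (auto simp: continuous_on_def)
  then show ?thesis
    using assms(4) unfolding eventually_at_topological dist_real_def by (metis Int_iff abs_zero diff_self)
qed

lemma continuous_on_real_nbhdI:
  fixes h :: "'a::topological_space \<Rightarrow> real"
  assumes "\<And>a e. a \<in> K \<Longrightarrow> e > 0 \<Longrightarrow> \<exists>U. open U \<and> a \<in> U \<and> (\<forall>b\<in>K \<inter> U. \<bar>h b - h a\<bar> < e)"
  shows "continuous_on K h"
  unfolding continuous_on_def
proof (intro ballI tendstoI)
  fix a and e :: real assume "a \<in> K" "e > 0"
  then obtain U where "open U" "a \<in> U" "\<forall>b\<in>K \<inter> U. \<bar>h b - h a\<bar> < e" using assms by blast
  then show "\<forall>\<^sub>F b in at a within K. dist (h b) (h a) < e"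
    unfolding eventually_at_topological dist_real_def by blast
qed

section \<open>Weighted averages and affine weights\<close>

lemma weighted_sum_bounds:
  fixes w a :: "'i \<Rightarrow> real"
  assumes "finite Z" "sum w Z = 1" "\<And>z. z \<in> Z \<Longrightarrow> 0 \<le> w z" "\<And>z. z \<in> Z \<Longrightarrow> l < a z \<and> a z < u"
  shows "l < (\<Sum>z\<in>Z. a z * w z)" "(\<Sum>z\<in>Z. a z * w z) < u"
proof -
  have "(\<Sum>z\<in>Z. w z *\<^sub>R a z) \<in> {l<..<u}"
    using assms by (intro convex_sum) auto
  then show "l < (\<Sum>z\<in>Z. a z * w z)" "(\<Sum>z\<in>Z. a z * w z) < u"
    by (simp_all add: mult.commute)
qed

lemma weighted_sum_diff_less:
  fixes w a b :: "'i \<Rightarrow> real"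
  assumes "finite Z" "sum w Z = 1" "\<And>z. z \<in> Z \<Longrightarrow> 0 \<le> w z" "\<And>z. z \<in> Z \<Longrightarrow> \<bar>a z - b z\<bar> < e"
  shows "\<bar>(\<Sum>z\<in>Z. a z * w z) - (\<Sum>z\<in>Z. b z * w z)\<bar> < e"
proof -
  have "- e < a z - b z \<and> a z - b z < e" if "z \<in> Z" for z
    using assms(4)[OF that] by linarith
  note bounds = weighted_sum_bounds[of Z w "- e" "\<lambda>z. a z - b z" e, OF assms(1-3) this]
  show ?thesis by (use bounds in \<open>simp add: left_diff_distrib sum_subtractf abs_less_iff\<close>)
qed

text \<open>The weights away from a base point \<open>z0\<close> solve a strict linear system. At \<open>x\<close> it is solved by
  nearly all mass at a net point close to \<open>x\<close>, the rest being spread evenly for strict positivity.\<close>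
lemma affine_partition_of_unity:
  fixes K :: "'a::{real_vector,t2_space} set"
  assumes E: "lctvs TYPE('a)" and K: "choquet_simplex K"
    and H: "finite H" "\<And>h. h \<in> H \<Longrightarrow> in_A K h" and e: "e > 0"
  obtains Z w where "finite Z" "Z \<subseteq> K" "\<And>z. z \<in> Z \<Longrightarrow> in_A K (w z)"
    "\<And>z x. z \<in> Z \<Longrightarrow> x \<in> K \<Longrightarrow> 0 \<le> w z x" "\<And>x. x \<in> K \<Longrightarrow> (\<Sum>z\<in>Z. w z x) = 1"
    "\<And>h x. h \<in> H \<Longrightarrow> x \<in> K \<Longrightarrow> \<bar>h x - (\<Sum>z\<in>Z. h z * w z x)\<bar> < e"
proof -
  have cK: "compact K" "K \<noteq> {}" using K by (auto simp: choquet_simplex_def)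
  obtain Z where Z: "finite Z" "Z \<subseteq> K" "\<And>x. x \<in> K \<Longrightarrow> \<exists>a\<in>Z. \<forall>h\<in>H. \<bar>h x - h a\<bar> < e / 2"
    by (rule compact_finite_net[OF cK(1), of "\<lambda>a x. \<forall>h\<in>H. \<bar>h x - h a\<bar> < e / 2"])
      (use finite_continuous_nbhd[OF H(1), of K "\<lambda>h. h" _ "e / 2"] H e in \<open>auto simp: in_A_def\<close>)
  obtain M where M: "M > 0" "\<And>h x. h \<in> H \<Longrightarrow> x \<in> K \<Longrightarrow> \<bar>h x\<bar> < M"
    using in_A_family_bounded[of H "\<lambda>_. K" "\<lambda>h. h"] H cK by blast
  obtain z0 where z0: "z0 \<in> Z" using Z(3) cK(2) by blast
  \<comment> \<open>The equation that the weights sum to 1 does not fit a strict system, so the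
    weight at \<open>z0\<close> is eliminated as 1 minus the others.\<close>
  define V where "V = Z - {z0}"
  have V: "finite V" "z0 \<notin> V" "Z = insert z0 V" using Z(1) z0 by (auto simp: V_def)
  \<comment> \<open>In the remaining variables \<open>pos\<close> makes the weights over
    \<open>V\<close> positive, the constraint with constants 1 does so for \<open>z0\<close>, and
    \<open>upper\<close> and \<open>lower\<close> are the two halves of the error bound after
    substituting for the weight at \<open>z0\<close>.\<close>
  define pos :: "(('a \<Rightarrow> real) \<times> ('a \<Rightarrow> real)) set"
    where "pos = (\<lambda>v. (\<lambda>u. if u = v then -1 else 0, \<lambda>_. 0)) ` V"
  define upper where "upper = (\<lambda>h. (\<lambda>v. h v - h z0, \<lambda>x. h x + (e - h z0))) ` H"
  define lower where "lower = (\<lambda>h. (\<lambda>v. h z0 - h v, \<lambda>x. (e + h z0) - h x)) ` H"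
  define Cs where "Cs = pos \<union> insert (\<lambda>_. 1, \<lambda>_. 1) (upper \<union> lower)"
  have split: "(\<Sum>v\<in>V. (h v - h z0) * y v) = (\<Sum>v\<in>Z. h v * y v) - h z0"
    if "(\<Sum>v\<in>Z. y v) = 1" for h y :: "'a \<Rightarrow> real"
  proof -
    have "y z0 = 1 - sum y V" using that V by simp
    then show ?thesis using V
      by (simp add: left_diff_distrib sum_subtractf right_diff_distrib flip: sum_distrib_left)
  qed
  have split': "(\<Sum>v\<in>V. (h z0 - h v) * y v) = h z0 - (\<Sum>v\<in>Z. h v * y v)"
    if "(\<Sum>v\<in>Z. y v) = 1" for h y :: "'a \<Rightarrow> real"
    using split[OF that, of h] by (simp add: left_diff_distrib sum_subtractf)
  have Cs_iff: "(\<forall>(c, b)\<in>Cs. (\<Sum>v\<in>V. c v * y v) < b x) \<longleftrightarrow> (\<forall>v\<in>V. 0 < y v) \<and> sum y V < 1 \<and>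
      (\<forall>h\<in>H. \<bar>h x - (\<Sum>v\<in>Z. h v * y v)\<bar> < e)"
    if "(\<Sum>v\<in>Z. y v) = 1" for x and y :: "'a \<Rightarrow> real"
  proof -
    have "(\<Sum>u\<in>V. (if u = v then -1 else 0) * y u) = - y v" if "v \<in> V" for v
      using that V(1) by (subst sum.remove[of _ v]) auto
    then have "(\<forall>(c, b)\<in>pos. (\<Sum>v\<in>V. c v * y v) < b x) \<longleftrightarrow> (\<forall>v\<in>V. 0 < y v)"
      by (simp add: pos_def)
    moreover have "(\<forall>(c, b)\<in>upper \<union> lower. (\<Sum>v\<in>V. c v * y v) < b x) \<longleftrightarrow>
      (\<forall>h\<in>H. \<bar>h x - (\<Sum>v\<in>Z. h v * y v)\<bar> < e)"
      by (simp add: upper_def lower_def split[OF that] split'[OF that] ball_Un abs_less_iff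
          ball_conj_distrib[symmetric]) (intro ball_cong; auto)
    ultimately show ?thesis by (simp add: Cs_def ball_Un) blast
  qed
  have "\<exists>Y. (\<forall>v\<in>V. in_A K (Y v)) \<and> (\<forall>x\<in>K. \<forall>(c, b)\<in>Cs. (\<Sum>v\<in>V. c v * Y v x) < b x)"
  proof (rule strict_linear_system_solvable[OF E K V(1)])
    show "finite Cs" using H V by (simp add: Cs_def pos_def upper_def lower_def)
    show "in_A K b" if "(c, b) \<in> Cs" for c b
      using that H(2)
      by (auto simp: Cs_def pos_def upper_def lower_def intro: in_A_const in_A_add in_A_diff)
  next
    fix x assume x: "x \<in> K"
    then obtain a where a: "a \<in> Z" "\<forall>h\<in>H. \<bar>h x - h a\<bar> < e / 2" using Z(3) by blast
    \<comment> \<open>Spreading a mass \<theta> evenly changes an average of \<open>h\<close> by at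
      most \<open>\<theta> * (2 * M)\<close>. This choice keeps that below \<open>e / 2\<close>, the
      other half being the distance to the net point.\<close>
    define \<theta> where "\<theta> = e / (e + 4 * M)"
    have \<theta>: "0 < \<theta>" "\<theta> < 1" "\<theta> * (2 * M) < e / 2"
      using e M(1) by (auto simp: \<theta>_def field_simps)
    define n where "n = real (card Z)"
    have n: "n > 0" using Z(1) z0 by (auto simp: n_def card_gt_0_iff)
    define y where "y v = (if v = a then 1 - \<theta> else 0) + \<theta> / n" for v
    have sum_y: "(\<Sum>v\<in>Z. c v * y v) = (1 - \<theta>) * c a + \<theta> * (\<Sum>v\<in>Z. c v * (1 / n))" for c
    proof -
      have "(\<Sum>v\<in>Z. c v * y v) = (\<Sum>v\<in>Z. if v = a then c a * (1 - \<theta>) else 0) + (\<Sum>v\<in>Z. c v * (\<theta> / n))"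
        unfolding sum.distrib[symmetric] by (intro sum.cong) (auto simp: y_def distrib_left)
      then show ?thesis using a(1) Z(1) by (simp add: sum_distrib_left mult_ac)
    qed
    have n1: "(\<Sum>v\<in>Z. 1 / n) = 1" using n by (simp add: n_def)
    have one: "(\<Sum>v\<in>Z. y v) = 1" using sum_y[of "\<lambda>_. 1"] n1 by simp
    have y_pos: "0 < y v" for v using \<theta> n by (simp add: y_def add_nonneg_pos)
    have "sum y V < 1" using one V y_pos[of z0] by simp
    moreover have "\<bar>h x - (\<Sum>v\<in>Z. h v * y v)\<bar> < e" if h: "h \<in> H" for h
    proof -
      have "- M < h v \<and> h v < M" if "v \<in> Z" for v
        using M(2)[OF h, of v] Z(2) that by (auto simp: abs_less_iff)
      then have "- M < (\<Sum>v\<in>Z. h v * (1 / n))" "(\<Sum>v\<in>Z. h v * (1 / n)) < M"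
        using weighted_sum_bounds[OF Z(1) n1, of "- M" h M] n by auto
      moreover have "\<bar>h a\<bar> < M" using M(2)[OF h] a(1) Z(2) by blast
      ultimately have "\<bar>h a - (\<Sum>v\<in>Z. h v * (1 / n))\<bar> \<le> 2 * M" by linarith
      then have "\<bar>\<theta> * (h a - (\<Sum>v\<in>Z. h v * (1 / n)))\<bar> \<le> \<theta> * (2 * M)"
        using \<theta>(1) by (simp add: abs_mult)
      moreover have "h x - (\<Sum>v\<in>Z. h v * y v) = (h x - h a) + \<theta> * (h a - (\<Sum>v\<in>Z. h v * (1 / n)))"
        unfolding sum_y by (simp add: algebra_simps)
      moreover have "\<bar>h x - h a\<bar> < e / 2" using a(2) h by blast
      ultimately show ?thesis using \<theta>(3) by linarith
    qed
    ultimately show "\<exists>y. \<forall>(c, b)\<in>Cs. (\<Sum>v\<in>V. c v * y v) < b x"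
      using Cs_iff[OF one, of x] y_pos by blast
  qed
  then obtain Y where Y: "\<And>v. v \<in> V \<Longrightarrow> in_A K (Y v)"
    "\<And>x. x \<in> K \<Longrightarrow> \<forall>(c, b)\<in>Cs. (\<Sum>v\<in>V. c v * Y v x) < b x"
    by blast
  define w where "w z x = (if z = z0 then 1 - (\<Sum>v\<in>V. Y v x) else Y z x)" for z x
  have wV: "w v x = Y v x" if "v \<in> V" for v x using that V(2) by (auto simp: w_def)
  have wz0: "w z0 = (\<lambda>x. 1 - (\<Sum>v\<in>V. Y v x))" by (auto simp: w_def)
  have w_sum: "(\<Sum>z\<in>Z. w z x) = 1" for x
    using V wV by (simp add: wz0)
  have w: "(\<forall>v\<in>V. 0 < w v x) \<and> (\<Sum>v\<in>V. w v x) < 1 \<and> (\<forall>h\<in>H. \<bar>h x - (\<Sum>v\<in>Z. h v * w v x)\<bar> < e)"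
    if "x \<in> K" for x
    using Cs_iff[OF w_sum, of x x] Y(2)[OF that] wV by simp
  show thesis
  proof (rule that[OF Z(1,2)])
    fix z assume z: "z \<in> Z"
    show "in_A K (w z)"
    proof (cases "z = z0")
      case True
      then show ?thesis using Y(1) wz0 by (auto intro!: in_A_diff in_A_const in_A_sum)
    next
      case False
      then have "z \<in> V" "w z = Y z" using z V by (auto simp: w_def)
      then show ?thesis using Y(1) by simp
    qed
    show "0 \<le> w z x" if "x \<in> K" for x
      using w[OF that] w_sum[of x] z V by (cases "z = z0") (auto simp: less_imp_le)
  qed (use w w_sum in auto)
qed

subsection \<open>Extension from a closed face\<close>

lemma supnorm_upper:
  assumes "compact K" "continuous_on K h" "x \<in> K"
  shows "\<bar>h x\<bar> \<le> supnorm K h"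
proof -
  have "bounded ((\<lambda>y. \<bar>h y\<bar>) ` K)"
    using assms by (intro compact_imp_bounded compact_continuous_image continuous_intros)
  then show ?thesis
    unfolding supnorm_def using assms(3) by (intro cSUP_upper bounded_imp_bdd_above)
qed

lemma supnorm_least: "K \<noteq> {} \<Longrightarrow> (\<And>x. x \<in> K \<Longrightarrow> \<bar>h x\<bar> \<le> c) \<Longrightarrow> supnorm K h \<le> c"
  unfolding supnorm_def by (rule cSUP_least)

lemma in_AA_D:
  assumes "in_AA L K f"
  shows "k \<in> L \<Longrightarrow> in_A K (f k)"
    and "x \<in> L \<Longrightarrow> y \<in> L \<Longrightarrow> 0 \<le> t \<Longrightarrow> t \<le> 1 \<Longrightarrow> z \<in> K \<Longrightarrow>
      f ((1 - t) *\<^sub>R x + t *\<^sub>R y) z = (1 - t) * f x z + t * f y z"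
  using assms by (auto simp: in_AA_def)

lemma in_AA_nbhd:
  assumes "in_AA L K f" "compact K" "k \<in> L" "e > 0"
  shows "\<exists>U. open U \<and> k \<in> U \<and> (\<forall>k'\<in>L \<inter> U. \<forall>z\<in>K. \<bar>f k' z - f k z\<bar> < e)"
proof -
  obtain U where U: "open U" "k \<in> U" "\<forall>k'\<in>L \<inter> U. supnorm K (\<lambda>z. f k' z - f k z) < e"
    using assms(1,3,4) unfolding in_AA_def by blast
  have "\<bar>f k' z - f k z\<bar> < e" if "k' \<in> L \<inter> U" "z \<in> K" for k' z
  proof -
    have "continuous_on K (\<lambda>z. f k' z - f k z)"
      using in_A_diff[OF in_AA_D(1)[OF assms(1)] in_AA_D(1)[OF assms(1)], of k' k] that assms(3)
      by (simp add: in_A_def)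
    note supnorm_upper[OF assms(2) this that(2)]
    also have "supnorm K (\<lambda>z. f k' z - f k z) < e" using U(3) that(1) by blast
    finally show ?thesis .
  qed
  then show ?thesis using U(1,2) by blast
qed

lemma in_AA_I:
  assumes "K \<noteq> {}" "\<And>k. k \<in> L \<Longrightarrow> in_A K (f k)"
    and "\<And>x y t z. x \<in> L \<Longrightarrow> y \<in> L \<Longrightarrow> 0 \<le> t \<Longrightarrow> t \<le> 1 \<Longrightarrow> z \<in> K \<Longrightarrow>
      f ((1 - t) *\<^sub>R x + t *\<^sub>R y) z = (1 - t) * f x z + t * f y z"
    and "\<And>k e. k \<in> L \<Longrightarrow> e > 0 \<Longrightarrow>
      \<exists>U. open U \<and> k \<in> U \<and> (\<forall>k'\<in>L \<inter> U. \<forall>z\<in>K. \<bar>f k' z - f k z\<bar> < e)"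
  shows "in_AA L K f"
  unfolding in_AA_def
proof (intro conjI ballI allI impI)
  fix k and e :: real assume "k \<in> L" "e > 0"
  \<comment> \<open>Half of \<open>e\<close>, since strict pointwise bounds pass to the supremum
    only as weak ones.\<close>
  then obtain U where U: "open U" "k \<in> U" "\<forall>k'\<in>L \<inter> U. \<forall>z\<in>K. \<bar>f k' z - f k z\<bar> < e / 2"
    using assms(4)[of k "e / 2"] by auto
  have "supnorm K (\<lambda>z. f k' z - f k z) < e" if "k' \<in> L \<inter> U" for k'
  proof -
    have "supnorm K (\<lambda>z. f k' z - f k z) \<le> e / 2"
      using U(3) that by (intro supnorm_least[OF assms(1)]) (auto simp: less_imp_le)
    then show ?thesis using \<open>e > 0\<close> by simp
  qed
  then show "\<exists>U. open U \<and> k \<in> U \<and> (\<forall>k'\<in>L \<inter> U. supnorm K (\<lambda>z. f k' z - f k z) < e)"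
    using U by blast
qed (use assms(2,3) in auto)

text \<open>This makes scalar interpolation on the first simplex available at each single point
  \<open>z\<close> of the second.\<close>

lemma in_AA_in_A_fst:
  assumes f: "in_AA L K f" "compact K" and z: "z \<in> K"
  shows "in_A L (\<lambda>k. f k z)"
  unfolding in_A_def
proof
  show "continuous_on L (\<lambda>k. f k z)"
  proof (rule continuous_on_real_nbhdI)
    fix k and e :: real assume "k \<in> L" "e > 0"
    from in_AA_nbhd[OF f this] z
    show "\<exists>U. open U \<and> k \<in> U \<and> (\<forall>k'\<in>L \<inter> U. \<bar>f k' z - f k z\<bar> < e)" by metis
  qed
  show "affine_fun_on L (\<lambda>k. f k z)"
    using in_AA_D(2)[OF f(1)] z by (auto simp: affine_fun_on_def)
qed

lemma in_AA_finite_net: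
  assumes "in_AA L K f" "compact K" "compact L" "e > 0"
  obtains T where "finite T" "T \<subseteq> L" "\<And>k. k \<in> L \<Longrightarrow> \<exists>t\<in>T. \<forall>z\<in>K. \<bar>f k z - f t z\<bar> < e"
  by (rule compact_finite_net[OF assms(3), of "\<lambda>t k. \<forall>z\<in>K. \<bar>f k z - f t z\<bar> < e",
        OF in_AA_nbhd[OF assms(1,2) _ assms(4)]]) (assumption, rule that)

lemma in_AA_bounded:
  assumes f: "in_AA L K f" "compact K" "compact L"
  obtains N where "\<And>k z. k \<in> L \<Longrightarrow> z \<in> K \<Longrightarrow> \<bar>f k z\<bar> \<le> N"
proof -
  obtain T where T: "finite T" "T \<subseteq> L" "\<And>k. k \<in> L \<Longrightarrow> \<exists>t\<in>T. \<forall>z\<in>K. \<bar>f k z - f t z\<bar> < 1"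
    using in_AA_finite_net[OF f, of 1] by auto
  obtain N where N: "\<And>t z. t \<in> T \<Longrightarrow> z \<in> K \<Longrightarrow> \<bar>f t z\<bar> < N"
    by (rule in_A_family_bounded[of T "\<lambda>_. K" f])
      (use T(1,2) f(2) in_AA_D(1)[OF f(1)] in auto)
  have "\<bar>f k z\<bar> \<le> N + 1" if "k \<in> L" "z \<in> K" for k z
    using T(3)[OF that(1)] N that(2) by fastforce
  then show thesis by (rule that)
qed

lemma in_AA_limit:
  assumes K: "K \<noteq> {}" "compact K" "convex K" and L: "convex L" and g: "\<And>n. in_AA L K (g n)"
    and \<epsilon>: "\<epsilon> \<longlonglongrightarrow> 0" and le: "\<And>n k z. k \<in> L \<Longrightarrow> z \<in> K \<Longrightarrow> \<bar>h k z - g n k z\<bar> \<le> \<epsilon> n"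
  shows "in_AA L K h"
proof -
  have lim: "(\<lambda>n. g n k z) \<longlonglongrightarrow> h k z" if "k \<in> L" "z \<in> K" for k z
  proof (rule Lim_transform2[OF tendsto_const])
    show "(\<lambda>n. h k z - g n k z) \<longlonglongrightarrow> 0"
      using le[OF that] by (intro tendsto_rabs_zero_cancel[OF tendsto_sandwich[OF _ _ tendsto_const \<epsilon>]]) auto
  qed
  have small: "\<exists>n. \<epsilon> n < e" if "e > 0" for e
    using order_tendstoD(2)[OF \<epsilon> that] by (auto simp: eventually_sequentially)
  show ?thesis
  proof (rule in_AA_I[OF K(1)])
    fix k assume k: "k \<in> L"
    show "in_A K (h k)"
      unfolding in_A_def
    proof
      have "uniform_limit K (\<lambda>n. g n k) (h k) sequentially"
      proof (rule uniform_limitI)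
        fix e :: real assume "e > 0"
        have "dist (g n k z) (h k z) < e" if "\<epsilon> n < e" "z \<in> K" for n z
          using le[OF k that(2), of n] that(1) by (simp add: dist_real_def abs_minus_commute)
        then show "\<forall>\<^sub>F n in sequentially. \<forall>z\<in>K. dist (g n k z) (h k z) < e"
          by (intro eventually_mono[OF order_tendstoD(2)[OF \<epsilon> \<open>e > 0\<close>]] ballI)
      qed
      then show "continuous_on K (h k)"
        using in_AA_D(1)[OF g k] by (intro uniform_limit_theorem[of _ "\<lambda>n. g n k"]) (auto simp: in_A_def)
    next
      show "affine_fun_on K (h k)"
        unfolding affine_fun_on_def
      proof (intro ballI)
        fix x y and t :: real assume xy: "x \<in> K" "y \<in> K" "t \<in> {0..1}"
        then have "(1 - t) *\<^sub>R x + t *\<^sub>R y \<in> K" using K(3) by (simp add: convexD)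
        then have "(\<lambda>n. g n k ((1 - t) *\<^sub>R x + t *\<^sub>R y)) \<longlonglongrightarrow> h k ((1 - t) *\<^sub>R x + t *\<^sub>R y)"
          by (rule lim[OF k])
        moreover have "g n k ((1 - t) *\<^sub>R x + t *\<^sub>R y) = (1 - t) * g n k x + t * g n k y" for n
          using in_AA_D(1)[OF g k, of n] xy by (simp add: in_A_def affine_fun_on_def)
        moreover have "(\<lambda>n. (1 - t) * g n k x + t * g n k y) \<longlonglongrightarrow> (1 - t) * h k x + t * h k y"
          by (intro tendsto_intros lim k xy)
        ultimately show "h k ((1 - t) *\<^sub>R x + t *\<^sub>R y) = (1 - t) * h k x + t * h k y"
          using LIMSEQ_unique by (simp only:) blast
      qed
    qed
  next
    fix x y z and t :: real assume xy: "x \<in> L" "y \<in> L" "0 \<le> t" "t \<le> 1" "z \<in> K"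
    then have "(1 - t) *\<^sub>R x + t *\<^sub>R y \<in> L" using L by (simp add: convexD)
    then have "(\<lambda>n. g n ((1 - t) *\<^sub>R x + t *\<^sub>R y) z) \<longlonglongrightarrow> h ((1 - t) *\<^sub>R x + t *\<^sub>R y) z"
      by (rule lim) fact
    moreover have "(\<lambda>n. (1 - t) * g n x z + t * g n y z) \<longlonglongrightarrow> (1 - t) * h x z + t * h y z"
      by (intro tendsto_intros lim xy)
    ultimately show "h ((1 - t) *\<^sub>R x + t *\<^sub>R y) z = (1 - t) * h x z + t * h y z"
      unfolding in_AA_D(2)[OF g xy] by (rule LIMSEQ_unique)
  next
    fix k and e :: real assume k: "k \<in> L" and e: "e > 0"
    obtain n where n: "\<epsilon> n < e / 3" using small[of "e / 3"] e by auto
    obtain U where U: "open U" "k \<in> U" "\<forall>k'\<in>L \<inter> U. \<forall>z\<in>K. \<bar>g n k' z - g n k z\<bar> < e / 3"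
      using in_AA_nbhd[OF g K(2) k, of "e / 3" n] e by auto
    have "\<bar>h k' z - h k z\<bar> < e" if "k' \<in> L \<inter> U" "z \<in> K" for k' z
    proof -
      have "\<bar>h k' z - g n k' z\<bar> \<le> \<epsilon> n" "\<bar>h k z - g n k z\<bar> \<le> \<epsilon> n" "\<bar>g n k' z - g n k z\<bar> < e / 3"
        using le U(3) that k by auto
      then show ?thesis using n by linarith
    qed
    then show "\<exists>U. open U \<and> k \<in> U \<and> (\<forall>k'\<in>L \<inter> U. \<forall>z\<in>K. \<bar>h k' z - h k z\<bar> < e)"
      using U(1,2) by blast
  qed
qed

text \<open>Averaging does not increase distances, so a neighbourhood that serves the finitely many
  \<open>b z\<close> serves the sum uniformly in \<open>x\<close>.\<close>

lemma in_AA_partition_sum: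
  assumes "K \<noteq> {}" "finite Z" "\<And>z. z \<in> Z \<Longrightarrow> in_A L (b z)" "\<And>z. z \<in> Z \<Longrightarrow> in_A K (w z)"
    and w: "\<And>z x. z \<in> Z \<Longrightarrow> x \<in> K \<Longrightarrow> 0 \<le> w z x" "\<And>x. x \<in> K \<Longrightarrow> (\<Sum>z\<in>Z. w z x) = 1"
  shows "in_AA L K (\<lambda>k x. \<Sum>z\<in>Z. b z k * w z x)"
proof (rule in_AA_I[OF assms(1)])
  show "in_A K (\<lambda>x. \<Sum>z\<in>Z. b z k * w z x)" for k
    using assms(4) by (intro in_A_sum in_A_cmult)
next
  fix x y v and t :: real assume "x \<in> L" "y \<in> L" "0 \<le> t" "t \<le> 1" "v \<in> K"
  then have "b z ((1 - t) *\<^sub>R x + t *\<^sub>R y) = (1 - t) * b z x + t * b z y" if "z \<in> Z" for z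
    using assms(3)[OF that] by (simp add: in_A_def affine_fun_on_def)
  then show "(\<Sum>z\<in>Z. b z ((1 - t) *\<^sub>R x + t *\<^sub>R y) * w z v) =
      (1 - t) * (\<Sum>z\<in>Z. b z x * w z v) + t * (\<Sum>z\<in>Z. b z y * w z v)"
    by (simp add: sum_distrib_left distrib_right mult.assoc flip: sum.distrib)
next
  fix k and e :: real assume "k \<in> L" "e > 0"
  then obtain U where U: "open U" "k \<in> U" "\<forall>k'\<in>L \<inter> U. \<forall>z\<in>Z. \<bar>b z k' - b z k\<bar> < e"
    using finite_continuous_nbhd[OF assms(2), of L b k e] assms(3) by (auto simp: in_A_def)
  have "\<bar>(\<Sum>z\<in>Z. b z k' * w z x) - (\<Sum>z\<in>Z. b z k * w z x)\<bar> < e" if "k' \<in> L \<inter> U" "x \<in> K" for k' x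
    using that U(3) w by (intro weighted_sum_diff_less assms(2)) auto
  then show "\<exists>U. open U \<and> k \<in> U \<and> (\<forall>k'\<in>L \<inter> U. \<forall>x\<in>K.
      \<bar>(\<Sum>z\<in>Z. b z k' * w z x) - (\<Sum>z\<in>Z. b z k * w z x)\<bar> < e)"
    using U(1,2) by blast
qed

text \<open>\<open>T\<close> is fixed before the weights, which can then be tailored to the finitely
  many \<open>f t\<close>. Each \<open>f k\<close> is reached through a nearby \<open>f t\<close>,
  at a cost of \<open>d\<close> at the point \<open>x\<close>, \<open>d\<close> inside the average
  and \<open>d\<close> for reproducing \<open>f t\<close>.\<close>

lemma in_AA_approximation:
  assumes f: "in_AA L K f" "compact K" "compact L" and d: "d > 0"
  obtains T where "finite T" "T \<subseteq> L"
    "\<And>Z w k x. finite Z \<Longrightarrow> Z \<subseteq> K \<Longrightarrow> (\<And>z. z \<in> Z \<Longrightarrow> 0 \<le> w z x) \<Longrightarrow> (\<Sum>z\<in>Z. w z x) = 1 \<Longrightarrow>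
      (\<And>t. t \<in> T \<Longrightarrow> \<bar>f t x - (\<Sum>z\<in>Z. f t z * w z x)\<bar> < d) \<Longrightarrow>
      k \<in> L \<Longrightarrow> x \<in> K \<Longrightarrow> \<bar>f k x - (\<Sum>z\<in>Z. f k z * w z x)\<bar> < 3 * d"
proof -
  obtain T where T: "finite T" "T \<subseteq> L" "\<And>k. k \<in> L \<Longrightarrow> \<exists>t\<in>T. \<forall>z\<in>K. \<bar>f k z - f t z\<bar> < d"
    by (rule in_AA_finite_net[OF f d]) blast
  show thesis
  proof (rule that[OF T(1,2)])
    fix Z and w :: "'b \<Rightarrow> 'b \<Rightarrow> real" and k x
    assume Z: "finite Z" "Z \<subseteq> K" "\<And>z. z \<in> Z \<Longrightarrow> 0 \<le> w z x" "(\<Sum>z\<in>Z. w z x) = 1"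
      and approx: "\<And>t. t \<in> T \<Longrightarrow> \<bar>f t x - (\<Sum>z\<in>Z. f t z * w z x)\<bar> < d" and "k \<in> L" "x \<in> K"
    obtain t where t: "t \<in> T" "\<And>z. z \<in> K \<Longrightarrow> \<bar>f k z - f t z\<bar> < d" using T(3)[OF \<open>k \<in> L\<close>] by blast
    have "\<bar>(\<Sum>z\<in>Z. f k z * w z x) - (\<Sum>z\<in>Z. f t z * w z x)\<bar> < d"
      using Z t(2) by (intro weighted_sum_diff_less) auto
    then show "\<bar>f k x - (\<Sum>z\<in>Z. f k z * w z x)\<bar> < 3 * d"
      using approx[OF t(1)] t(2)[OF \<open>x \<in> K\<close>] by linarith
  qed
qed

text \<open>On \<open>F\<close> the interpolation and the averaging each cost \<open>e / 4\<close>,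
  which halves the error. On \<open>K1\<close> the change is below \<open>e + e / 4\<close>; the
  bound \<open>2 * e\<close> is summable once \<open>e\<close> is halved at every step.\<close>

lemma approximate_extension_step:
  fixes K1 F :: "'a::{real_vector,t2_space} set" and K2 :: "'b::{real_vector,t2_space} set"
  assumes E: "lctvs TYPE('a)" "lctvs TYPE('b)"
    and K: "choquet_simplex K1" "choquet_simplex K2"
    and F: "F face_of K1" "closed F" "F \<noteq> {}"
    and f: "in_AA F K2 f" "\<And>k z. k \<in> F \<Longrightarrow> z \<in> K2 \<Longrightarrow> 0 \<le> f k z \<and> f k z \<le> r"
    and g: "in_AA K1 K2 g" "\<And>k z. k \<in> K1 \<Longrightarrow> z \<in> K2 \<Longrightarrow> - e < g k z \<and> g k z < r + e"
    and fg: "\<And>k z. k \<in> F \<Longrightarrow> z \<in> K2 \<Longrightarrow> \<bar>g k z - f k z\<bar> < e" and e: "e > 0"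
  obtains g' where "in_AA K1 K2 g'"
    "\<And>k z. k \<in> K1 \<Longrightarrow> z \<in> K2 \<Longrightarrow> - (e / 2) < g' k z \<and> g' k z < r + e / 2"
    "\<And>k z. k \<in> F \<Longrightarrow> z \<in> K2 \<Longrightarrow> \<bar>g' k z - f k z\<bar> < e / 2"
    "\<And>k z. k \<in> K1 \<Longrightarrow> z \<in> K2 \<Longrightarrow> \<bar>g' k z - g k z\<bar> < 2 * e"
proof -
  have cK: "compact K1" "compact K2" "K2 \<noteq> {}" "K1 \<noteq> {}" "convex K1" "K1 face_of K1" "closed K1"
    using K by (auto simp: choquet_simplex_def face_of_refl compact_imp_closed)
  have FK: "F \<subseteq> K1" using F(1) by (rule face_of_imp_subset)
  have cF: "compact F" using compact_Int_closed[OF cK(1) F(2)] FK by (simp add: Int_absorb1)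
  have r: "0 \<le> r" using f(2) F(3) cK(3) by force
  \<comment> \<open>The approximation lemma triples the error, giving \<open>e / 4\<close>.\<close>
  have d: "e / 12 > 0" using e by simp
  obtain T1 where T1: "finite T1" "T1 \<subseteq> F"
    "\<And>Z w k x. finite Z \<Longrightarrow> Z \<subseteq> K2 \<Longrightarrow> (\<And>z. z \<in> Z \<Longrightarrow> 0 \<le> w z x) \<Longrightarrow> (\<Sum>z\<in>Z. w z x) = 1 \<Longrightarrow>
      (\<And>t. t \<in> T1 \<Longrightarrow> \<bar>f t x - (\<Sum>z\<in>Z. f t z * w z x)\<bar> < e / 12) \<Longrightarrow>
      k \<in> F \<Longrightarrow> x \<in> K2 \<Longrightarrow> \<bar>f k x - (\<Sum>z\<in>Z. f k z * w z x)\<bar> < 3 * (e / 12)"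
    by (fact in_AA_approximation[OF f(1) cK(2) cF d])
  obtain T2 where T2: "finite T2" "T2 \<subseteq> K1"
    "\<And>Z w k x. finite Z \<Longrightarrow> Z \<subseteq> K2 \<Longrightarrow> (\<And>z. z \<in> Z \<Longrightarrow> 0 \<le> w z x) \<Longrightarrow> (\<Sum>z\<in>Z. w z x) = 1 \<Longrightarrow>
      (\<And>t. t \<in> T2 \<Longrightarrow> \<bar>g t x - (\<Sum>z\<in>Z. g t z * w z x)\<bar> < e / 12) \<Longrightarrow>
      k \<in> K1 \<Longrightarrow> x \<in> K2 \<Longrightarrow> \<bar>g k x - (\<Sum>z\<in>Z. g k z * w z x)\<bar> < 3 * (e / 12)"
    by (fact in_AA_approximation[OF g(1) cK(2) cK(1) d])
  have H: "finite (f ` T1 \<union> g ` T2)" "\<And>h. h \<in> f ` T1 \<union> g ` T2 \<Longrightarrow> in_A K2 h"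
    using T1(1,2) T2(1,2) in_AA_D(1)[OF f(1)] in_AA_D(1)[OF g(1)] by auto
  obtain Z w where Z: "finite Z" "Z \<subseteq> K2" and w: "\<And>z. z \<in> Z \<Longrightarrow> in_A K2 (w z)"
    "\<And>z x. z \<in> Z \<Longrightarrow> x \<in> K2 \<Longrightarrow> 0 \<le> w z x" "\<And>x. x \<in> K2 \<Longrightarrow> (\<Sum>z\<in>Z. w z x) = 1"
    and approx: "\<And>h x. h \<in> f ` T1 \<union> g ` T2 \<Longrightarrow> x \<in> K2 \<Longrightarrow> \<bar>h x - (\<Sum>z\<in>Z. h z * w z x)\<bar> < e / 12"
    by (rule affine_partition_of_unity[OF E(2) K(2) H d]) (assumption, rule that)
  have f_approx: "\<bar>f k x - (\<Sum>z\<in>Z. f k z * w z x)\<bar> < e / 4" if "k \<in> F" "x \<in> K2" for k x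
    using T1(3)[OF Z w(2) w(3) _ that] approx that by fastforce
  have g_approx: "\<bar>g k x - (\<Sum>z\<in>Z. g k z * w z x)\<bar> < e / 4" if "k \<in> K1" "x \<in> K2" for k x
    using T2(3)[OF Z w(2) w(3) _ that] approx that by fastforce
  have "\<exists>b. in_A K1 b \<and> (\<forall>k\<in>K1. - (e / 2) < b k \<and> b k < r + e / 2 \<and> \<bar>b k - g k z\<bar> < e) \<and>
      (\<forall>k\<in>F. \<bar>b k - f k z\<bar> < e / 4)" if z: "z \<in> Z" for z
  proof -
    have zK: "z \<in> K2" using z Z(2) by blast
    note fz = in_AA_in_A_fst[OF f(1) cK(2) zK] and gz = in_AA_in_A_fst[OF g(1) cK(2) zK]
    \<comment> \<open>The hypotheses on \<open>g\<close> make the lower and upper constraints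
      compatible: its distance below \<open>e\<close> to the interval from 0 to \<open>r\<close>
      settles the halved margin against \<open>g k z - e\<close> and \<open>g k z + e\<close>, and
      \<open>fg\<close> settles the latter against the tight bounds around \<open>f\<close> on
      \<open>F\<close>.\<close>
    define P where "P = {(K1, \<lambda>_. - (e / 2)), (K1, \<lambda>k. g k z - e), (F, \<lambda>k. f k z - e / 4)}"
    define Q where "Q = {(K1, \<lambda>_. r + e / 2), (K1, \<lambda>k. g k z + e), (F, \<lambda>k. f k z + e / 4)}"
    have faces: "face_functions K1 P" "face_functions K1 Q"
      using fz gz F cK(4-) by (auto simp: face_functions_def P_def Q_def
          intro: in_A_const in_A_diff in_A_add)
    have less: "p x < q x" if pq: "(S, p) \<in> P" "(T, q) \<in> Q" and x: "x \<in> S" "x \<in> T" for S p T q x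
    proof -
      have "x \<in> K1" using pq(1) x(1) FK by (auto simp: P_def)
      note 1 = g(2)[OF this zK]
      show ?thesis
      proof (cases "x \<in> F")
        case True
        have "f x z - e < g x z" "g x z < f x z + e" using fg[OF True zK] by linarith+
        then show ?thesis using pq e r 1 f(2)[OF True zK] by (auto simp: P_def Q_def)
      next
        case False
        then show ?thesis using pq x e r 1 by (auto simp: P_def Q_def)
      qed
    qed
    obtain b where b: "in_A K1 b" "\<And>S p x. (S, p) \<in> P \<Longrightarrow> x \<in> S \<Longrightarrow> p x < b x"
      "\<And>S q x. (S, q) \<in> Q \<Longrightarrow> x \<in> S \<Longrightarrow> b x < q x"
      by (rule strict_interpolation[OF E(1) K(1) faces]) (rule less, assumption+, rule that)
    have "- (e / 2) < b k \<and> b k < r + e / 2 \<and> \<bar>b k - g k z\<bar> < e" if "k \<in> K1" for k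
    proof -
      have "- (e / 2) < b k" "g k z - e < b k" using b(2)[of K1 _ k] that by (force simp: P_def)+
      moreover have "b k < r + e / 2" "b k < g k z + e" using b(3)[of K1 _ k] that by (force simp: Q_def)+
      ultimately show ?thesis by linarith
    qed
    moreover have "\<bar>b k - f k z\<bar> < e / 4" if "k \<in> F" for k
    proof -
      have "f k z - e / 4 < b k" using b(2)[of F "\<lambda>k. f k z - e / 4" k] that by (simp add: P_def)
      moreover have "b k < f k z + e / 4" using b(3)[of F "\<lambda>k. f k z + e / 4" k] that by (simp add: Q_def)
      ultimately show ?thesis by linarith
    qed
    ultimately show ?thesis using b(1) by blast
  qed
  then have "\<exists>b. \<forall>z\<in>Z. in_A K1 (b z) \<and>
      (\<forall>k\<in>K1. - (e / 2) < b z k \<and> b z k < r + e / 2 \<and> \<bar>b z k - g k z\<bar> < e) \<and>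
      (\<forall>k\<in>F. \<bar>b z k - f k z\<bar> < e / 4)"
    by (intro bchoice ballI)
  then obtain b where "\<forall>z\<in>Z. in_A K1 (b z) \<and>
      (\<forall>k\<in>K1. - (e / 2) < b z k \<and> b z k < r + e / 2 \<and> \<bar>b z k - g k z\<bar> < e) \<and>
      (\<forall>k\<in>F. \<bar>b z k - f k z\<bar> < e / 4)"
    by (rule exE)
  then have b: "\<And>z. z \<in> Z \<Longrightarrow> in_A K1 (b z)"
    "\<And>z k. z \<in> Z \<Longrightarrow> k \<in> K1 \<Longrightarrow> - (e / 2) < b z k \<and> b z k < r + e / 2"
    "\<And>z k. z \<in> Z \<Longrightarrow> k \<in> K1 \<Longrightarrow> \<bar>b z k - g k z\<bar> < e"
    "\<And>z k. z \<in> Z \<Longrightarrow> k \<in> F \<Longrightarrow> \<bar>b z k - f k z\<bar> < e / 4"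
    by blast+
  show thesis
  proof (rule that)
    show "in_AA K1 K2 (\<lambda>k x. \<Sum>z\<in>Z. b z k * w z x)"
      using b(1) w by (intro in_AA_partition_sum[OF cK(3) Z(1)])
  next
    fix k x assume kx: "k \<in> K1" "x \<in> K2"
    note W = Z(1) w(3)[OF kx(2)] w(2)[OF _ kx(2)]
    show "- (e / 2) < (\<Sum>z\<in>Z. b z k * w z x) \<and> (\<Sum>z\<in>Z. b z k * w z x) < r + e / 2"
      using weighted_sum_bounds[OF W b(2)[OF _ kx(1)]] by simp
    have "\<bar>(\<Sum>z\<in>Z. b z k * w z x) - (\<Sum>z\<in>Z. g k z * w z x)\<bar> < e"
      by (rule weighted_sum_diff_less[OF W b(3)[OF _ kx(1)]])
    then show "\<bar>(\<Sum>z\<in>Z. b z k * w z x) - g k x\<bar> < 2 * e"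
      using g_approx[OF kx] e by linarith
  next
    fix k x assume kx: "k \<in> F" "x \<in> K2"
    have "\<bar>(\<Sum>z\<in>Z. b z k * w z x) - (\<Sum>z\<in>Z. f k z * w z x)\<bar> < e / 4"
      by (rule weighted_sum_diff_less[OF Z(1) w(3)[OF kx(2)] w(2)[OF _ kx(2)] b(4)[OF _ kx(1)]])
    then show "\<bar>(\<Sum>z\<in>Z. b z k * w z x) - f k x\<bar> < e / 2"
      using f_approx[OF kx] by linarith
  qed
qed

text \<open>Each approximation obeys the bounds and the extension condition up to a strict margin
  \<open>\<epsilon> n\<close>; as the margins vanish, the limit satisfies the closed conditions
  exactly.\<close>

theorem nonnegative_affine_extension:
  fixes K1 F :: "'a::{real_vector,t2_space} set" and K2 :: "'b::{real_vector,t2_space} set"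
  assumes E: "lctvs TYPE('a)" "lctvs TYPE('b)"
    and K: "choquet_simplex K1" "choquet_simplex K2"
    and F: "F face_of K1" "closed F" "F \<noteq> {}"
    and f: "in_AA F K2 f" "\<And>k z. k \<in> F \<Longrightarrow> z \<in> K2 \<Longrightarrow> 0 \<le> f k z \<and> f k z \<le> r"
  obtains g where "in_AA K1 K2 g" "\<And>k z. k \<in> K1 \<Longrightarrow> z \<in> K2 \<Longrightarrow> 0 \<le> g k z \<and> g k z \<le> r"
    "\<And>k z. k \<in> F \<Longrightarrow> z \<in> K2 \<Longrightarrow> g k z = f k z"
proof -
  have cK: "compact K2" "K2 \<noteq> {}" "convex K1" "convex K2"
    using K by (auto simp: choquet_simplex_def)
  have FK: "F \<subseteq> K1" using F(1) by (rule face_of_imp_subset)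
  have r: "0 \<le> r" using f(2) F(3) cK(2) by force
  \<comment> \<open>The initial error \<open>r + 1\<close> is large enough for the zero map to be
    the first approximation.\<close>
  define \<epsilon> where "\<epsilon> n = (r + 1) / 2 ^ n" for n :: nat
  have \<epsilon>: "\<epsilon> n > 0" "\<epsilon> (Suc n) = \<epsilon> n / 2" for n using r by (simp_all add: \<epsilon>_def)
  have \<epsilon>_lim: "\<epsilon> \<longlonglongrightarrow> 0"
    unfolding \<epsilon>_def by (intro LIMSEQ_divide_realpow_zero) simp
  define P where "P n g \<longleftrightarrow> in_AA K1 K2 g \<and>
    (\<forall>k\<in>K1. \<forall>z\<in>K2. - \<epsilon> n < g k z \<and> g k z < r + \<epsilon> n) \<and>
    (\<forall>k\<in>F. \<forall>z\<in>K2. \<bar>g k z - f k z\<bar> < \<epsilon> n)" for n g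
  have "\<exists>G. \<forall>n. P n (G n) \<and> (\<forall>k\<in>K1. \<forall>z\<in>K2. \<bar>G (Suc n) k z - G n k z\<bar> < 2 * \<epsilon> n)"
  proof (rule dependent_nat_choice)
    have "in_AA K1 K2 (\<lambda>_ _. 0)"
      using cK(2) by (intro in_AA_I) (auto intro: in_A_const)
    then have "P 0 (\<lambda>_ _. 0)" using r f(2) by (fastforce simp: P_def \<epsilon>_def)
    then show "\<exists>g. P 0 g" by blast
  next
    fix g n assume g: "P n g"
    obtain g' where "in_AA K1 K2 g'"
      "\<And>k z. k \<in> K1 \<Longrightarrow> z \<in> K2 \<Longrightarrow> - (\<epsilon> n / 2) < g' k z \<and> g' k z < r + \<epsilon> n / 2"
      "\<And>k z. k \<in> F \<Longrightarrow> z \<in> K2 \<Longrightarrow> \<bar>g' k z - f k z\<bar> < \<epsilon> n / 2"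
      "\<And>k z. k \<in> K1 \<Longrightarrow> z \<in> K2 \<Longrightarrow> \<bar>g' k z - g k z\<bar> < 2 * \<epsilon> n"
      by (rule approximate_extension_step[OF E K F f, of g "\<epsilon> n"]) (use g \<epsilon>(1)[of n] in \<open>auto simp: P_def\<close>)
    then show "\<exists>g'. P (Suc n) g' \<and> (\<forall>k\<in>K1. \<forall>z\<in>K2. \<bar>g' k z - g k z\<bar> < 2 * \<epsilon> n)"
      by (intro exI[of _ g']) (simp add: P_def \<epsilon>(2))
  qed
  then obtain G where G: "\<And>n. P n (G n)"
    "\<And>n k z. k \<in> K1 \<Longrightarrow> z \<in> K2 \<Longrightarrow> \<bar>G (Suc n) k z - G n k z\<bar> < 2 * \<epsilon> n"
    by blast
  \<comment> \<open>The increments telescope because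
    \<open>2 * \<epsilon> n = 4 * \<epsilon> n - 4 * \<epsilon> (Suc n)\<close>.\<close>
  have tail: "\<bar>G (n + m) k z - G n k z\<bar> \<le> 4 * \<epsilon> n - 4 * \<epsilon> (n + m)" if "k \<in> K1" "z \<in> K2" for n m k z
  proof (induct m)
    case (Suc m)
    then show ?case using G(2)[OF that, of "n + m"] \<epsilon>(2)[of "n + m"] by simp
  qed simp
  have tail': "\<bar>G m k z - G n k z\<bar> \<le> 4 * \<epsilon> n" if "k \<in> K1" "z \<in> K2" "n \<le> m" for n m k z
    using tail[OF that(1,2), of n "m - n"] that(3) \<epsilon>(1)[of m] by simp
  have conv: "convergent (\<lambda>n. G n k z)" if "k \<in> K1" "z \<in> K2" for k z
  proof -
    have "Cauchy (\<lambda>n. G n k z)"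
    proof (rule metric_CauchyI)
      fix e :: real assume "e > 0"
      then obtain N where N: "\<epsilon> N < e / 8"
        using order_tendstoD(2)[OF \<epsilon>_lim, of "e / 8"] by (auto simp: eventually_sequentially)
      have "dist (G m k z) (G n k z) < e" if "m \<ge> N" "n \<ge> N" for m n
        using tail'[OF \<open>k \<in> K1\<close> \<open>z \<in> K2\<close>, of N m] tail'[OF \<open>k \<in> K1\<close> \<open>z \<in> K2\<close>, of N n] that N
        unfolding dist_real_def by linarith
      then show "\<exists>N. \<forall>m\<ge>N. \<forall>n\<ge>N. dist (G m k z) (G n k z) < e" by blast
    qed
    then show ?thesis by (rule Cauchy_convergent)
  qed
  define g where "g k z = lim (\<lambda>n. G n k z)" for k z
  have lim: "(\<lambda>n. G n k z) \<longlonglongrightarrow> g k z" if "k \<in> K1" "z \<in> K2" for k z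
    using conv[OF that] unfolding g_def by (simp add: convergent_LIMSEQ_iff)
  show thesis
  proof (rule that)
    show "in_AA K1 K2 g"
    proof (rule in_AA_limit[OF cK(2,1,4,3)])
      show "in_AA K1 K2 (G n)" for n using G(1) by (simp add: P_def)
      show "(\<lambda>n. 4 * \<epsilon> n) \<longlonglongrightarrow> 0" using tendsto_mult_left[OF \<epsilon>_lim, of 4] by simp
      show "\<bar>g k z - G n k z\<bar> \<le> 4 * \<epsilon> n" if "k \<in> K1" "z \<in> K2" for n k z
        by (rule LIMSEQ_le_const2[OF tendsto_rabs[OF tendsto_diff[OF lim[OF that] tendsto_const]]])
          (use tail'[OF that] in blast)
    qed
  next
    fix k z assume kz: "k \<in> K1" "z \<in> K2"
    have "- \<epsilon> n \<le> G n k z" "G n k z \<le> r + \<epsilon> n" for n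
      using G(1)[of n] kz by (auto simp: P_def less_imp_le)
    moreover have "(\<lambda>n. - \<epsilon> n) \<longlonglongrightarrow> 0" "(\<lambda>n. r + \<epsilon> n) \<longlonglongrightarrow> r"
      using tendsto_minus[OF \<epsilon>_lim] tendsto_add[OF tendsto_const \<epsilon>_lim, of r] by simp_all
    ultimately show "0 \<le> g k z \<and> g k z \<le> r"
      using LIMSEQ_le[OF _ lim[OF kz]] LIMSEQ_le[OF lim[OF kz]] by blast
  next
    fix k z assume kz: "k \<in> F" "z \<in> K2"
    have "(\<lambda>n. \<bar>G n k z - f k z\<bar>) \<longlonglongrightarrow> 0"
      using G(1) kz by (intro tendsto_sandwich[OF _ _ tendsto_const \<epsilon>_lim])
        (auto simp: P_def less_imp_le)
    then have "(\<lambda>n. G n k z) \<longlonglongrightarrow> f k z"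
      by (simp add: tendsto_rabs_zero_iff LIM_zero_iff)
    then show "g k z = f k z" using lim kz FK LIMSEQ_unique by blast
  qed
qed

theorem theorem9:
  fixes K1 F :: "'a::{real_vector,t2_space} set"
    and K2 :: "'b::{real_vector,t2_space} set"
    and f :: "'a \<Rightarrow> 'b \<Rightarrow> real"
  assumes "lctvs TYPE('a)" and "lctvs TYPE('b)"
    and "choquet_simplex K1" and "choquet_simplex K2"
    and "F face_of K1" and "closed F" and "F \<noteq> {}"
    and "in_AA F K2 f"
    and "\<forall>k\<in>F. \<forall>z\<in>K2. 0 \<le> f k z"
  shows "\<exists>g. in_AA K1 K2 g \<and> (\<forall>k\<in>K1. \<forall>z\<in>K2. 0 \<le> g k z) \<and>
             (\<forall>k\<in>F. \<forall>z\<in>K2. g k z = f k z) \<and>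
             (SUP k\<in>K1. supnorm K2 (g k)) = (SUP k\<in>F. supnorm K2 (f k))"
proof -
  have cK: "compact K1" "compact K2" "K2 \<noteq> {}"
    using assms(3,4) by (auto simp: choquet_simplex_def)
  have FK: "F \<subseteq> K1" using assms(5) by (rule face_of_imp_subset)
  have cF: "compact F" using compact_Int_closed[OF cK(1) assms(6)] FK by (simp add: Int_absorb1)
  define r where "r = (SUP k\<in>F. supnorm K2 (f k))"
  \<comment> \<open>A real supremum bounds its terms only when the set is bounded above, so
    boundedness of \<open>f\<close> on \<open>F\<close> comes first.\<close>
  obtain N where "\<And>k z. k \<in> F \<Longrightarrow> z \<in> K2 \<Longrightarrow> \<bar>f k z\<bar> \<le> N"
    by (rule in_AA_bounded[OF assms(8) cK(2) cF]) blast
  then have "supnorm K2 (f k) \<le> N" if "k \<in> F" for k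
    using that by (intro supnorm_least[OF cK(3)])
  then have bdd: "bdd_above ((\<lambda>k. supnorm K2 (f k)) ` F)" by (intro bdd_aboveI[of _ N]) auto
  have bounds: "0 \<le> f k z \<and> f k z \<le> r" if "k \<in> F" "z \<in> K2" for k z
  proof -
    have "\<bar>f k z\<bar> \<le> supnorm K2 (f k)"
      using in_AA_D(1)[OF assms(8) that(1)] by (intro supnorm_upper[OF cK(2) _ that(2)]) (simp add: in_A_def)
    also have "\<dots> \<le> r" unfolding r_def using that by (intro cSUP_upper bdd)
    finally show ?thesis using assms(9) that by simp
  qed
  \<comment> \<open>For non-negative functions a norm bound by \<open>r\<close> is the pointwise
    bound by \<open>r\<close>, so the extension theorem gives one inequality between the norms; the
    other holds because \<open>F\<close> lies in \<open>K1\<close> and \<open>g\<close> agrees with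
    \<open>f\<close> there.\<close>
  obtain g where g: "in_AA K1 K2 g" "\<And>k z. k \<in> K1 \<Longrightarrow> z \<in> K2 \<Longrightarrow> 0 \<le> g k z \<and> g k z \<le> r"
    "\<And>k z. k \<in> F \<Longrightarrow> z \<in> K2 \<Longrightarrow> g k z = f k z"
    by (rule nonnegative_affine_extension[OF assms(1-8) bounds]) (assumption+, rule that)
  have le: "supnorm K2 (g k) \<le> r" if "k \<in> K1" for k
    using g(2)[OF that] by (intro supnorm_least[OF cK(3)]) auto
  then have bdd': "bdd_above ((\<lambda>k. supnorm K2 (g k)) ` K1)" by (intro bdd_aboveI[of _ r]) auto
  have eq: "supnorm K2 (g k) = supnorm K2 (f k)" if "k \<in> F" for k
    using g(3)[OF that] by (simp add: supnorm_def)
  have "(SUP k\<in>K1. supnorm K2 (g k)) = r"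
  proof (rule antisym)
    show "(SUP k\<in>K1. supnorm K2 (g k)) \<le> r"
      using le assms(7) FK by (intro cSUP_least) auto
    show "r \<le> (SUP k\<in>K1. supnorm K2 (g k))"
      unfolding r_def using assms(7) FK eq
      by (intro cSUP_mono bdd') (auto intro!: bexI[of _ _ K1])
  qed
  then show ?thesis using g unfolding r_def by blast
qed

end
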